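(* There exists an infinite sequence of truncated graphic matroids $M_1, M_2, \dots$ with total orderings $\mathcal{O}_1, \mathcal{O}_2, \dots$ of their ground sets such that, for every $n \ge 1$, $M_n$ has $\mathrm{poly}(n)$ elements, and there exists a face $\tau$ of the broken circuit complex $X = \mathrm{NBC}(M_n, \mathcal{O}_n)$ for which the down-up walk on the facets of the link $X_\tau$ (with the uniform distribution on facets of $X$) has spectral gap at most $n^{-\Omega(n)}$.
   Context: A matroid $M=(E,\mathcal{I})$ has ground set $E$ and a family $\mathcal{I}$ of independent sets; its bases are maximal independent sets. A circuit is a minimal dependent set. Given a total ordering $\mathcal{O}$ of $E$, a broken circuit is a set $C\setminus\{e\}$ where $C$ is a circuit and $e$ is the smallest element of $C$ under $\mathcal{O}$. An NBC independent set is an independent set containing no broken circuit; an NBC basis is a basis containing no broken circuit. The NBC independent sets form a pure simplicial complex $\mathrm{NBC}(M,\mathcal{O})$, the broken circuit complex, whose facets are the NBC bases. A graphic matroid is defined on the edge set of a graph, with independent sets the acyclic edge subsets (forests). The truncation of a rank-$r$ matroid to rank $r'\le r$ keeps only independent sets of size at most $r'$. For a simplicial complex $X$ and face $\tau$, the link is $X_\tau=\{\sigma\setminus\tau : \sigma\in X, \sigma\supseteq\tau\}$; its facets inherit the distribution induced from the distribution on facets of $X$ (here uniform), conditioned on containing $\tau$. The down-up walk on facets of a pure complex of dimension $d$ with distribution $\pi$ moves from facet $\sigma$ by removing a uniformly random element $x\in\sigma$, then choosing a facet containing $\sigma\setminus\{x\}$ with probability proportional to $\pi$. The spectral gap of a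 walk with transition matrix $P$ is $1-\lambda_2(P)$. *)

theory Defs
  imports
    "HOL-Library.Countable_Set"
    "HOL-Library.Multiset"
    "HOL-Probability.Probability_Mass_Function"
    "Jordan_Normal_Form.Char_Poly"
begin

section \<open>Matroids given by independent sets\<close>

text \<open>A matroid is represented by the pair of its ground set and its family of independent sets.\<close>

type_synonym 'a matroid = "'a set \<times> 'a set set"

abbreviation ground :: "'a matroid \<Rightarrow> 'a set" where
  "ground M \<equiv> fst M"

abbreviation indep :: "'a matroid \<Rightarrow> 'a set set" where
  "indep M \<equiv> snd M"

definition bases :: "'a matroid \<Rightarrow> 'a set set" where
  "bases M = {B \<in> indep M. \<forall>B' \<in> indep M. B \<subseteq> B' \<longrightarrow> B' = B}"

definition circuits :: "'a matroid \<Rightarrow> 'a set set" where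
  "circuits M = {C. C \<subseteq> ground M \<and> C \<notin> indep M \<and> (\<forall>D. D \<subset> C \<longrightarrow> D \<in> indep M)}"

definition matroid_rank :: "'a matroid \<Rightarrow> nat" where
  "matroid_rank M = Max (card ` bases M)"

definition truncation :: "nat \<Rightarrow> 'a matroid \<Rightarrow> 'a matroid" where
  "truncation k M = (ground M, {I \<in> indep M. card I \<le> k})"

section \<open>Graphic matroids\<close>

definition simple_graph :: "'v set \<Rightarrow> 'v set set \<Rightarrow> bool" where
  "simple_graph V E \<longleftrightarrow> finite V \<and> (\<forall>e \<in> E. e \<subseteq> V \<and> card e = 2)"

text \<open>A cycle is given by its cyclic sequence of distinct vertices.\<close>

definition graph_cycle :: "'v set set \<Rightarrow> 'v list \<Rightarrow> bool" where
  "graph_cycle F vs \<longleftrightarrow> 3 \<le> length vs \<and> distinct vs \<and>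
     (\<forall>i < length vs. {vs ! i, vs ! (Suc i mod length vs)} \<in> F)"

definition acyclic_edges :: "'v set set \<Rightarrow> bool" where
  "acyclic_edges F \<longleftrightarrow> (\<nexists>vs. graph_cycle F vs)"

definition graphic_matroid :: "'v set set \<Rightarrow> 'v set matroid" where
  "graphic_matroid E = (E, {F. F \<subseteq> E \<and> acyclic_edges F})"

definition truncated_graphic_matroid :: "'v set matroid \<Rightarrow> bool" where
  "truncated_graphic_matroid M \<longleftrightarrow>
     (\<exists>V E k. simple_graph V E \<and> k \<le> matroid_rank (graphic_matroid E) \<and>
        M = truncation k (graphic_matroid E))"

section \<open>Broken circuit complex\<close>

text \<open>In the following, the pair \<open>(x, y)\<close> belongs to the order relation \<open>r\<close> iff
  \<open>x\<close> is at most \<open>y\<close>.\<close>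

definition broken_circuits :: "'a matroid \<Rightarrow> 'a rel \<Rightarrow> 'a set set" where
  "broken_circuits M r =
     {C - {e} | C e. C \<in> circuits M \<and> e \<in> C \<and> (\<forall>x \<in> C. (e, x) \<in> r)}"

definition nbc_complex :: "'a matroid \<Rightarrow> 'a rel \<Rightarrow> 'a set set" where
  "nbc_complex M r = {S \<in> indep M. \<not> (\<exists>B \<in> broken_circuits M r. B \<subseteq> S)}"

section \<open>Simplicial complexes and the down-up walk\<close>

definition facets :: "'a set set \<Rightarrow> 'a set set" where
  "facets X = {\<sigma> \<in> X. \<forall>\<sigma>' \<in> X. \<sigma> \<subseteq> \<sigma>' \<longrightarrow> \<sigma>' = \<sigma>}"

definition link :: "'a set set \<Rightarrow> 'a set \<Rightarrow> 'a set set" where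
  "link X \<tau> = {\<sigma> - \<tau> | \<sigma>. \<sigma> \<in> X \<and> \<tau> \<subseteq> \<sigma>}"

definition link_pmf :: "'a set pmf \<Rightarrow> 'a set \<Rightarrow> 'a set pmf" where
  "link_pmf \<pi> \<tau> = map_pmf (\<lambda>\<sigma>. \<sigma> - \<tau>) (cond_pmf \<pi> {\<sigma>. \<tau> \<subseteq> \<sigma>})"

text \<open>One step of the down-up walk for the facet distribution \<open>\<pi>\<close>, started at the facet \<open>\<sigma>\<close>.
  This is meaningful for finite nonempty \<open>\<sigma>\<close> in the support of \<open>\<pi>\<close>.\<close>

definition down_up :: "'a set pmf \<Rightarrow> 'a set \<Rightarrow> 'a set pmf" where
  "down_up \<pi> \<sigma> =
     bind_pmf (pmf_of_set \<sigma>) (\<lambda>x. cond_pmf \<pi> {\<sigma>'. \<sigma> - {x} \<subseteq> \<sigma>'})"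

section \<open>Spectral gap\<close>

text \<open>The finite state space \<open>S\<close> is enumerated as \<open>from_nat_into S 0, \<dots>,
  from_nat_into S (card S - 1)\<close>; another enumeration gives a similar matrix.\<close>

definition transition_matrix :: "'s set \<Rightarrow> ('s \<Rightarrow> 's pmf) \<Rightarrow> real mat" where
  "transition_matrix S K =
     mat (card S) (card S) (\<lambda>(i, j). pmf (K (from_nat_into S i)) (from_nat_into S j))"

text \<open>The real eigenvalues, repeated according to algebraic multiplicity, in decreasing order.
  For a reversible walk, such as the down-up walk, these are all the eigenvalues.\<close>

definition real_eigenvalues :: "real mat \<Rightarrow> real list" where
  "real_eigenvalues A = rev (sorted_list_of_multiset (proots (char_poly A)))"

text \<open>List positions start at 0, so position 1 holds the second largest eigenvalue. It is only
  meaningful if there are at least two states.\<close>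

definition spectral_gap :: "'s set \<Rightarrow> ('s \<Rightarrow> 's pmf) \<Rightarrow> real" where
  "spectral_gap S K = 1 - real_eigenvalues (transition_matrix S K) ! 1"

text \<open>The gap of the down-up walk on the facets of the link of \<open>\<tau>\<close> in \<open>X\<close>, where the facets of
  \<open>X\<close> are distributed uniformly.\<close>

definition link_gap :: "'a set set \<Rightarrow> 'a set \<Rightarrow> real" where
  "link_gap X \<tau> =
     spectral_gap (facets (link X \<tau>)) (down_up (link_pmf (pmf_of_set (facets X)) \<tau>))"

end

theory Submission
  imports Defs "Jordan_Normal_Form.Schur_Decomposition"
begin

text \<open>
  Take \<open>2 N\<close> stars with \<open>q\<close> leaves each, call the first \<open>N\<close> of them left and the others right, join every
  left centre to every right centre, and join all leaves to a common hub. In the order, the edges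
  between centres come first, then the star edges, then the spokes at the hub; the face \<open>\<tau>\<close>
  consists of all star edges. A left and a right spoke together with two star edges form
  the broken circuit of a five-cycle, so a facet of the link contains spokes on one side only.
  Each choice of one spoke per star on one side extends to a facet, which gives at least \<open>q\<^sup>N\<close>
  facets on each side, whereas the walk can leave the left side only from a facet with a single
  left spoke, whose other \<open>2 N - 1\<close> edges are among the \<open>N\<^sup>2\<close> edges between centres. With \<open>q\<close> a
  large power of \<open>N\<close> this is a bottleneck of relative size \<open>N\<close> to the power \<open>- \<Omega>(N)\<close>. Truncating
  at the full rank changes nothing, so no proper truncation is needed.
\<close>

text \<open>Contracting \<open>\<tau>\<close> shows the design: every star becomes one vertex, these
  \<open>2 * N\<close> vertices carry a complete bipartite graph, and the hub is joined to each of
  them by \<open>q\<close> parallel edges. The leaves merely subdivide these parallel edges, because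
  the graph has to be simple. Facets of the link are spanning trees there. Every spoke contributes a
  factor \<open>q\<close> to their number, so trees with a single spoke are rare; they number at
  most about \<open>q\<close> times \<open>N\<close> to the power \<open>4 * N\<close>, hence
  \<open>q\<close> has to beat \<open>N ^ 4\<close> by a fixed power of \<open>N\<close>. The gap is
  read off the sorted roots of a characteristic polynomial, so a test function can bound it only
  after an orthogonal diagonalization. This is available because the facets are uniformly
  distributed and of equal size, which makes the transition matrix symmetric and not merely
  reversible.\<close>

section \<open>Second eigenvalue and conductance\<close>

lemma real_orthogonal_completion:
  fixes v :: "real vec"
  assumes v: "v \<in> carrier_vec n" "v \<noteq> 0\<^sub>v n"
  obtains U c where "U \<in> carrier_mat n n" "U\<^sup>T * U = 1\<^sub>m n" "U * U\<^sup>T = 1\<^sub>m n"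
    "col U 0 = c \<cdot>\<^sub>v v"
proof -
  interpret cof_vec_space n "TYPE(real)" .
  define b where "b = basis_completion v"
  define ws where "ws = gram_schmidt n b"
  have n0: "n \<noteq> 0"
    using v by (metis carrier_vecD eq_vecI less_nat_zero_code zero_carrier_vec)
  from basis_completion[OF v, folded b_def]
  have dist_b: "distinct b" and indep: "\<not> lin_dep (set b)" and b: "set b \<subseteq> carrier_vec n"
    and hdb: "hd b = v" and len_b: "length b = n" by auto
  from hdb len_b n0 obtain vs where bv: "b = v # vs" by (cases b, auto)
  from gram_schmidt_result[OF b dist_b indep refl, folded ws_def]
  have ws: "set ws \<subseteq> carrier_vec n" "corthogonal ws" "length ws = n"
    by (auto simp: len_b)
  from gram_schmidt_hd[OF v(1), of vs, folded bv] have hdws: "hd ws = v" unfolding ws_def .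
  \<comment> \<open>Gram-Schmidt yields orthogonal vectors of arbitrary length. Dividing by the
    lengths \<open>r\<close> makes the columns of \<open>U\<close> orthonormal and keeps the first
    one parallel to \<open>v\<close>.\<close>
  define r where "r i = sqrt (ws ! i \<bullet> ws ! i)" for i
  define U where "U = mat n n (\<lambda>(i, j). ws ! j $ i / r j)"
  have wc: "ws ! i \<in> carrier_vec n" if "i < n" for i
    using ws that by auto
  have orth: "ws ! i \<bullet> ws ! j = 0 \<longleftrightarrow> i \<noteq> j" if "i < n" "j < n" for i j
    using corthogonalD[OF ws(2), of i j] that ws(3) wc by simp
  have pos: "ws ! i \<bullet> ws ! i > 0" if "i < n" for i
  proof -
    have "ws ! i \<bullet> ws ! i \<ge> 0"
      by (simp add: scalar_prod_def sum_nonneg)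
    then show ?thesis using orth[OF that that] by simp
  qed
  have U: "U \<in> carrier_mat n n" by (simp add: U_def)
  have UU: "U\<^sup>T * U = 1\<^sub>m n"
  proof (rule eq_matI)
    fix i j assume "i < dim_row (1\<^sub>m n :: real mat)" "j < dim_col (1\<^sub>m n :: real mat)"
    then have ij: "i < n" "j < n" by auto
    have "(U\<^sup>T * U) $$ (i, j) = (\<Sum>k<n. (ws ! i $ k / r i) * (ws ! j $ k / r j))"
      using ij by (simp add: U_def scalar_prod_def atLeast0LessThan)
    also have "\<dots> = (ws ! i \<bullet> ws ! j) / (r i * r j)"
      using wc[OF ij(2)]
      by (simp add: scalar_prod_def atLeast0LessThan sum_divide_distrib)
    also have "\<dots> = (1\<^sub>m n) $$ (i, j)"
      using ij orth[OF ij] pos[OF ij(1)] by (auto simp: r_def)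
    finally show "(U\<^sup>T * U) $$ (i, j) = (1\<^sub>m n) $$ (i, j)" .
  qed (auto simp: U_def)
  have UU': "U * U\<^sup>T = 1\<^sub>m n"
    using mat_mult_left_right_inverse[OF _ U UU] U by simp
  have "ws ! 0 = v" using hdws ws(3) n0 by (metis hd_conv_nth length_0_conv)
  then have "col U 0 = (1 / r 0) \<cdot>\<^sub>v v"
    using n0 v by (intro eq_vecI) (auto simp: U_def)
  with U UU UU' show ?thesis using that by blast
qed

text \<open>The fundamental theorem of algebra gives a complex root \<open>z\<close>. Evaluating the
  Hermitian form of \<open>A\<close> at an eigenvector in two ways shows that \<open>z\<close> times
  the squared norm \<open>s\<close> equals \<open>cnj z * s\<close>, so \<open>z\<close> is
  real.\<close>

lemma real_symmetric_eigenvalue_exists: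
  fixes A :: "real mat"
  assumes A: "A \<in> carrier_mat n n" and sym: "A\<^sup>T = A" and n: "n \<noteq> 0"
  obtains e where "eigenvalue A e"
proof -
  define B where "B = map_mat complex_of_real A"
  have B: "B \<in> carrier_mat n n" using A by (simp add: B_def)
  have "degree (char_poly B) = n" using degree_monic_char_poly[OF B] by simp
  then have "\<not> constant (poly (char_poly B))"
    using n by (simp add: constant_degree)
  then obtain z where z: "poly (char_poly B) z = 0"
    using fundamental_theorem_of_algebra by blast
  then have "eigenvalue B z" using eigenvalue_root_char_poly[OF B] by simp
  then obtain v where v: "v \<in> carrier_vec n" "v \<noteq> 0\<^sub>v n" "B *\<^sub>v v = z \<cdot>\<^sub>v v"
    using B unfolding eigenvalue_def eigenvector_def by auto
  define s where "s = (\<Sum>i<n. v $ i * cnj (v $ i))"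
  have entry: "(\<Sum>j<n. complex_of_real (A $$ (i, j)) * v $ j) = z * v $ i" if "i < n" for i
  proof -
    have "(B *\<^sub>v v) $ i = z * v $ i" using v that by simp
    then show ?thesis
      using that v A by (simp add: B_def scalar_prod_def atLeast0LessThan)
  qed
  have Asym: "A $$ (i, j) = A $$ (j, i)" if "i < n" "j < n" for i j
    using sym A that by (metis carrier_matD(1,2) index_transpose_mat(1))
  have "z * s = (\<Sum>i<n. (\<Sum>j<n. complex_of_real (A $$ (i, j)) * v $ j) * cnj (v $ i))"
    unfolding s_def sum_distrib_left by (intro sum.cong refl) (simp add: entry)
  also have "\<dots> = (\<Sum>i<n. \<Sum>j<n. complex_of_real (A $$ (i, j)) * v $ j * cnj (v $ i))"
    by (simp add: sum_distrib_right)
  also have "\<dots> = (\<Sum>j<n. \<Sum>i<n. complex_of_real (A $$ (i, j)) * v $ j * cnj (v $ i))"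
    by (rule sum.swap)
  also have "\<dots> = (\<Sum>j<n. v $ j * cnj (\<Sum>i<n. complex_of_real (A $$ (j, i)) * v $ i))"
    unfolding cnj_sum sum_distrib_left
    by (intro sum.cong refl) (simp add: Asym mult_ac)
  also have "\<dots> = cnj z * s"
    unfolding s_def sum_distrib_left
    by (intro sum.cong refl, subst entry) (simp_all add: mult_ac)
  finally have "z * s = cnj z * s" .
  moreover have "s \<noteq> 0"
  proof -
    obtain i where i: "i < n" "v $ i \<noteq> 0"
      using v(1,2) by (metis carrier_vecD eq_vecI index_zero_vec(1,2))
    have "s = of_real (\<Sum>i<n. (cmod (v $ i))\<^sup>2)"
      by (simp add: s_def complex_norm_square del: of_real_power)
    moreover have "(\<Sum>i<n. (cmod (v $ i))\<^sup>2) > 0"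
      by (rule sum_pos2[of _ i]) (use i in auto)
    ultimately show ?thesis by (metis less_irrefl of_real_eq_0_iff)
  qed
  ultimately have "z = cnj z" by simp
  then have "z = of_real (Re z)" by (metis complex_cnj_cancel_iff Reals_cnj_iff complex_is_Real_iff of_real_Re)
  moreover have "char_poly B = map_poly complex_of_real (char_poly A)"
    unfolding B_def by (rule of_real_hom.char_poly_hom[OF A])
  ultimately have "poly (map_poly complex_of_real (char_poly A)) (of_real (Re z)) = 0"
    using z by simp
  then have "poly (char_poly A) (Re z) = 0" by simp
  then show ?thesis using that eigenvalue_root_char_poly[OF A] by blast
qed

lemma mult_block_diagonal_mat:
  fixes A :: "'a :: comm_ring_1 mat"
  assumes "A \<in> carrier_mat k k" "B \<in> carrier_mat n n" "C \<in> carrier_mat k k" "D \<in> carrier_mat n n"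
  shows "four_block_mat A (0\<^sub>m k n) (0\<^sub>m n k) B * four_block_mat C (0\<^sub>m k n) (0\<^sub>m n k) D
    = four_block_mat (A * C) (0\<^sub>m k n) (0\<^sub>m n k) (B * D)"
proof -
  have "A * C + 0\<^sub>m k n * 0\<^sub>m n k = A * C" "A * 0\<^sub>m k n + 0\<^sub>m k n * D = 0\<^sub>m k n"
    "0\<^sub>m n k * C + B * 0\<^sub>m n k = 0\<^sub>m n k" "0\<^sub>m n k * 0\<^sub>m k n + B * D = B * D"
    using assms by auto
  then show ?thesis
    by (simp only: mult_four_block_mat[OF assms(1) zero_carrier_mat zero_carrier_mat assms(2)
          assms(3) zero_carrier_mat zero_carrier_mat assms(4)])
qed

text \<open>Deflation: in an orthonormal basis that starts with an eigenvector, symmetry splits the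
  matrix into one eigenvalue and a symmetric block of smaller dimension.\<close>

theorem real_symmetric_diagonalization:
  fixes A :: "real mat"
  assumes "A \<in> carrier_mat n n" and "A\<^sup>T = A"
  obtains U D where "U \<in> carrier_mat n n" "D \<in> carrier_mat n n" "U\<^sup>T * U = 1\<^sub>m n"
    "U * U\<^sup>T = 1\<^sub>m n" "A = U * D * U\<^sup>T" "diagonal_mat D"
proof -
  have "\<exists>U D. U \<in> carrier_mat n n \<and> D \<in> carrier_mat n n \<and> U\<^sup>T * U = 1\<^sub>m n
     \<and> A = U * D * U\<^sup>T \<and> diagonal_mat D"
    using assms
  proof (induction n arbitrary: A)
    case 0
    then show ?case
      by (intro exI[of _ A]) (auto simp: diagonal_mat_def)
  next
    case (Suc n A)
    from Suc.prems have A: "A \<in> carrier_mat (Suc n) (Suc n)" and sym: "A\<^sup>T = A" by auto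
    obtain e where "eigenvalue A e"
      using real_symmetric_eigenvalue_exists[OF A sym] by auto
    then obtain v where v: "v \<in> carrier_vec (Suc n)" "v \<noteq> 0\<^sub>v (Suc n)" "A *\<^sub>v v = e \<cdot>\<^sub>v v"
      using A unfolding eigenvalue_def eigenvector_def by auto
    obtain U c where U: "U \<in> carrier_mat (Suc n) (Suc n)" "U\<^sup>T * U = 1\<^sub>m (Suc n)"
        "U * U\<^sup>T = 1\<^sub>m (Suc n)" "col U 0 = c \<cdot>\<^sub>v v"
      using real_orthogonal_completion[OF v(1,2)] by blast
    define B where "B = U\<^sup>T * (A * U)"
    have B: "B \<in> carrier_mat (Suc n) (Suc n)" using A U by (auto simp: B_def)
    have Bsym: "B\<^sup>T = B"
    proof -
      have "B\<^sup>T = (A * U)\<^sup>T * U"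
        unfolding B_def by (subst transpose_mult[of _ "Suc n" "Suc n"]) (use A U in auto)
      also have "(A * U)\<^sup>T = U\<^sup>T * A"
        by (subst transpose_mult[of _ "Suc n" "Suc n"]) (use A U sym in auto)
      also have "U\<^sup>T * A * U = B"
        unfolding B_def by (rule assoc_mult_mat) (use A U in auto)
      finally show ?thesis .
    qed
    have ABU: "A = U * B * U\<^sup>T"
    proof -
      have "U * B = (U * U\<^sup>T) * (A * U)"
        unfolding B_def by (rule assoc_mult_mat[symmetric]) (use A U in auto)
      also have "\<dots> = A * U" using A U by simp
      finally have "U * B * U\<^sup>T = A * (U * U\<^sup>T)"
        using A U by (simp add: assoc_mult_mat[of _ "Suc n" "Suc n" _ "Suc n" _ "Suc n"])
      then show ?thesis using A U by simp
    qed
    have col0: "B $$ (i, 0) = (if i = 0 then e else 0)" if i: "i < Suc n" for i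
    proof -
      have "B $$ (i, 0) = row U\<^sup>T i \<bullet> col (A * U) 0"
        using i A U by (simp add: B_def)
      also have "col (A * U) 0 = A *\<^sub>v col U 0"
        by (rule col_mult2[OF A U(1)]) simp
      also have "\<dots> = e \<cdot>\<^sub>v col U 0"
        using A v unfolding U(4)
        by (simp add: mult_mat_vec[OF A v(1)] smult_smult_assoc mult.commute)
      also have "row U\<^sup>T i \<bullet> (e \<cdot>\<^sub>v col U 0) = e * (row U\<^sup>T i \<bullet> col U 0)"
        using U(1) by (intro scalar_prod_smult_right) simp
      also have "row U\<^sup>T i \<bullet> col U 0 = (U\<^sup>T * U) $$ (i, 0)"
        using U(1) i by simp
      finally show ?thesis using i by (simp add: U(2))
    qed
    define B3 where "B3 = mat n n (\<lambda>(i, j). B $$ (Suc i, Suc j))"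
    define E where "E = mat 1 1 (\<lambda>_. e)"
    have Bsym': "B $$ (i, j) = B $$ (j, i)" if "i < Suc n" "j < Suc n" for i j
      using Bsym B that by (metis carrier_matD(1,2) index_transpose_mat(1))
    have B3: "B3 \<in> carrier_mat n n" "B3\<^sup>T = B3"
      by (auto simp: B3_def intro!: eq_matI Bsym')
    have E: "E \<in> carrier_mat 1 1" "E\<^sup>T = E" by (auto simp: E_def)
    have Bblock: "B = four_block_mat E (0\<^sub>m 1 n) (0\<^sub>m n 1) B3"
    proof (rule eq_matI)
      fix i j
      assume "i < dim_row (four_block_mat E (0\<^sub>m 1 n) (0\<^sub>m n 1) B3)"
        "j < dim_col (four_block_mat E (0\<^sub>m 1 n) (0\<^sub>m n 1) B3)"
      then have ij: "i < Suc n" "j < Suc n" using B3 E by auto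
      \<comment> \<open>Symmetry carries the zeros of the first column over to the first
        row.\<close>
      have "B $$ (0, j) = B $$ (j, 0)" using ij by (intro Bsym') auto
      then show "B $$ (i, j) = four_block_mat E (0\<^sub>m 1 n) (0\<^sub>m n 1) B3 $$ (i, j)"
        using ij B3 E col0[OF ij(1)] col0[OF ij(2)]
        by (cases i; cases j) (auto simp: E_def B3_def)
    qed (use B B3 E in auto)
    from Suc.IH[OF B3] obtain V D where V: "V \<in> carrier_mat n n" "D \<in> carrier_mat n n"
      "V\<^sup>T * V = 1\<^sub>m n" "B3 = V * D * V\<^sup>T" "diagonal_mat D" by auto
    define W where "W = four_block_mat (1\<^sub>m 1) (0\<^sub>m 1 n) (0\<^sub>m n 1) V"
    define F where "F = four_block_mat E (0\<^sub>m 1 n) (0\<^sub>m n 1) D"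
    have one: "1\<^sub>m 1 \<in> carrier_mat 1 (1::nat)" by simp
    have z: "0\<^sub>m 1 n \<in> carrier_mat 1 n" "0\<^sub>m n 1 \<in> carrier_mat n 1" by auto
    have WT: "W\<^sup>T = four_block_mat (1\<^sub>m 1) (0\<^sub>m 1 n) (0\<^sub>m n 1) V\<^sup>T"
      unfolding W_def using V
      by (subst transpose_four_block_mat[of _ 1 1 _ n _ n]) auto
    have VT: "V\<^sup>T \<in> carrier_mat n n" using V by auto
    have W: "W \<in> carrier_mat (Suc n) (Suc n)" "F \<in> carrier_mat (Suc n) (Suc n)"
      using four_block_carrier_mat[OF one V(1)] four_block_carrier_mat[OF E(1) V(2)]
      by (simp_all add: W_def F_def)
    have "W\<^sup>T * W = four_block_mat (1\<^sub>m 1) (0\<^sub>m 1 n) (0\<^sub>m n 1) (1\<^sub>m n)"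
      unfolding WT unfolding W_def mult_block_diagonal_mat[OF one VT one V(1)] by (simp add: V(3))
    also have "\<dots> = 1\<^sub>m (1 + n)" by (rule four_block_one_mat)
    finally have WW: "W\<^sup>T * W = 1\<^sub>m (Suc n)" by simp
    have VD: "V * D \<in> carrier_mat n n" using V by simp
    have "W * F = four_block_mat E (0\<^sub>m 1 n) (0\<^sub>m n 1) (V * D)"
      unfolding F_def W_def mult_block_diagonal_mat[OF one V(1) E(1) V(2)]
      unfolding left_mult_one_mat[OF E(1)] by (rule refl)
    then have WFW: "W * F * W\<^sup>T = B"
      unfolding WT Bblock V(4)
      by (simp only: mult_block_diagonal_mat[OF E(1) VD one VT] right_mult_one_mat[OF E(1)])
    have F: "diagonal_mat F"
      using V(2,5) E unfolding diagonal_mat_def F_def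
      by (auto simp: less_Suc_eq_0_disj) blast
    define X where "X = U * W"
    have X: "X \<in> carrier_mat (Suc n) (Suc n)" using U W by (auto simp: X_def)
    have XT: "X\<^sup>T = W\<^sup>T * U\<^sup>T"
      unfolding X_def by (rule transpose_mult) (use U W in auto)
    note assoc = assoc_mult_mat[of _ "Suc n" "Suc n" _ "Suc n" _ "Suc n"]
    have "X\<^sup>T * X = W\<^sup>T * ((U\<^sup>T * U) * W)"
      unfolding XT unfolding X_def using U(1) W by (simp add: assoc)
    then have XX: "X\<^sup>T * X = 1\<^sub>m (Suc n)" using U(2) W WW by simp
    have "X * F * X\<^sup>T = U * (W * F * W\<^sup>T) * U\<^sup>T"
      unfolding XT unfolding X_def using U(1) W by (simp add: assoc)
    then have "A = X * F * X\<^sup>T" using WFW ABU by simp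
    with X W XX F show ?case by blast
  qed
  then obtain U D where UD: "U \<in> carrier_mat n n" "D \<in> carrier_mat n n" "U\<^sup>T * U = 1\<^sub>m n"
     "A = U * D * U\<^sup>T" "diagonal_mat D" by auto
  moreover have "U * U\<^sup>T = 1\<^sub>m n"
    using mat_mult_left_right_inverse[OF _ UD(1,3)] UD(1) by simp
  ultimately show ?thesis using that by blast
qed

section \<open>From sorted eigenvalues to a bottleneck bound\<close>

lemma real_eigenvalues_orthogonal_similar:
  assumes U: "U \<in> carrier_mat n n" "U\<^sup>T * U = 1\<^sub>m n" "U * U\<^sup>T = 1\<^sub>m n"
    and D: "D \<in> carrier_mat n n" "diagonal_mat D"
  shows "real_eigenvalues (U * D * U\<^sup>T) = rev (sort (diag_mat D))"
proof -
  have "similar_mat (U * D * U\<^sup>T) D"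
    by (rule similar_matI[of _ _ U "U\<^sup>T" n]) (use U D in auto)
  then have "char_poly (U * D * U\<^sup>T) = char_poly D" by (rule char_poly_similar)
  also have "\<dots> = (\<Prod>a\<leftarrow>diag_mat D. [:- a, 1:])"
    by (rule char_poly_upper_triangular[OF D(1)])
      (use D in \<open>auto simp: diagonal_mat_def upper_triangular_def\<close>)
  finally have cp: "char_poly (U * D * U\<^sup>T) = (\<Prod>a\<leftarrow>diag_mat D. [:- a, 1:])" .
  have "proots (\<Prod>a\<leftarrow>xs. [:- a, 1:]) = mset xs" for xs :: "real list"
  proof (induction xs)
    case (Cons x xs)
    have "(\<Prod>a\<leftarrow>xs. [:- a, 1:]) \<noteq> 0" by (auto simp: prod_list_zero_iff)
    then show ?case
      using Cons by (simp add: proots_mult del: mult_pCons_left mult_pCons_right)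
  qed simp
  then show ?thesis by (simp add: real_eigenvalues_def cp)
qed

text \<open>In a decreasing list only the head can exceed the entry at position 1, whereas two large
  entries of \<open>xs\<close> would need two places. Applied to the diagonal, this leaves at most
  one eigenvalue above the second one.\<close>

lemma second_largest_ge_min:
  fixes xs :: "'a :: linorder list"
  assumes ij: "i < length xs" "j < length xs" "i \<noteq> j"
  shows "min (xs ! i) (xs ! j) \<le> rev (sort xs) ! 1"
proof (rule ccontr)
  assume "\<not> ?thesis"
  define ys where "ys = rev (sort xs)"
  define m where "m = ys ! 1"
  from \<open>\<not> ?thesis\<close> have gt: "xs ! i > m" "xs ! j > m" by (simp_all add: m_def ys_def not_le)
  have len: "length ys = length xs" "mset ys = mset xs" by (simp_all add: ys_def)
  have "card {i, j} \<le> card {k. k < length xs \<and> xs ! k > m}"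
    using gt ij by (intro card_mono) auto
  also have "\<dots> = length (filter (\<lambda>x. x > m) xs)" by (simp add: length_filter_conv_card)
  also have "\<dots> = length (filter (\<lambda>x. x > m) ys)"
    using len(2) by (metis mset_filter size_mset)
  also have "\<dots> = card {k. k < length ys \<and> ys ! k > m}" by (simp add: length_filter_conv_card)
  also have "\<dots> \<le> card {0 :: nat}"
  proof (intro card_mono subsetI)
    fix k assume k: "k \<in> {k. k < length ys \<and> ys ! k > m}"
    show "k \<in> {0}"
    proof (rule ccontr)
      assume "k \<notin> {0}"
      then have "1 \<le> k" by simp
      moreover have "sorted (rev ys)" by (simp add: ys_def)
      ultimately have "ys ! k \<le> ys ! 1" using k by (intro sorted_rev_nth_mono) auto
      with k show False by (simp add: m_def leD)
    qed
  qed simp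
  finally show False using ij by simp
qed

text \<open>The test function takes the value \<open>a\<close> on \<open>T\<close> and \<open>b\<close> off \<open>T\<close>, chosen orthogonal to the
  only eigenvector whose eigenvalue may exceed the second one.\<close>

theorem spectral_gap_le_conductance:
  assumes S: "finite S" and T: "T \<subseteq> S" "T \<noteq> {}" "T \<noteq> S"
    and sym: "\<And>s t. s \<in> S \<Longrightarrow> t \<in> S \<Longrightarrow> pmf (K s) t = pmf (K t) s"
    and supp: "\<And>s. s \<in> S \<Longrightarrow> set_pmf (K s) \<subseteq> S"
  shows "spectral_gap S K * (real (card T) * real (card (S - T)))
    \<le> real (card S) * (\<Sum>s\<in>T. \<Sum>t\<in>S - T. pmf (K s) t)"
proof -
  define n where "n = card S"
  define h where "h = from_nat_into S"
  have h: "bij_betw h {..<n} S"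
    unfolding h_def n_def by (rule bij_betw_from_nat_into_finite[OF S])
  have hS: "h i \<in> S" if "i < n" for i using bij_betwE[OF h] that by auto
  define A where "A = transition_matrix S K"
  have A: "A \<in> carrier_mat n n" by (simp add: A_def transition_matrix_def n_def)
  have Aij: "A $$ (i, j) = pmf (K (h i)) (h j)" if "i < n" "j < n" for i j
    using that by (simp add: A_def transition_matrix_def n_def h_def)
  have "A\<^sup>T = A"
    using A by (intro eq_matI) (auto simp: Aij hS intro: sym)
  then obtain U D where UD: "U \<in> carrier_mat n n" "D \<in> carrier_mat n n" "U\<^sup>T * U = 1\<^sub>m n"
    "U * U\<^sup>T = 1\<^sub>m n" "A = U * D * U\<^sup>T" "diagonal_mat D"
    using real_symmetric_diagonalization[OF A] by blast
  have UT: "U\<^sup>T \<in> carrier_mat n n" using UD by simp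
  define d where "d k = D $$ (k, k)" for k
  define m where "m = real_eigenvalues A ! 1"
  have gap: "spectral_gap S K = 1 - m" by (simp add: spectral_gap_def m_def A_def)
  have two: "d i \<le> m \<or> d j \<le> m" if "i < n" "j < n" "i \<noteq> j" for i j
    using second_largest_ge_min[of i "diag_mat D" j] that UD(2)
    by (auto simp: m_def UD(5) real_eigenvalues_orthogonal_similar[OF UD(1,3,4,2,6)]
        diag_mat_def d_def)
  \<comment> \<open>\<open>k0\<close> is the index of the one eigenvalue that may exceed
    \<open>m\<close>. If there is none, any index serves and \<open>0\<close> is taken.\<close>
  then obtain k0 where k0: "k0 < n \<Longrightarrow> k < n \<Longrightarrow> k \<noteq> k0 \<Longrightarrow> d k \<le> m" "n > 0 \<Longrightarrow> k0 < n" for k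
  proof (cases "\<exists>k<n. m < d k")
    case True
    then obtain k0 where "k0 < n" "m < d k0" by auto
    then have "d k \<le> m" if "k < n" "k \<noteq> k0" for k
      using two[of k0 k] that by auto
    with \<open>k0 < n\<close> show ?thesis by (intro that[of k0])
  next
    case False
    then have "d k \<le> m" if "k < n" for k using that by force
    then show ?thesis by (intro that[of 0])
  qed
  have "S \<noteq> {}" using T by auto
  then have "n > 0" using S by (simp add: n_def card_gt_0_iff)
  note k0 = k0(1)[OF k0(2)[OF this]] k0(2)[OF this]
  \<comment> \<open>\<open>p\<close> and \<open>q\<close> are the inner products of the eigenvector
    at \<open>k0\<close> with the indicators of \<open>T\<close> and of its complement. The
    functions constant on both parts form a plane, which contains a nonzero vector orthogonal to
    that eigenvector.\<close>
  define p where "p = (\<Sum>i | i < n \<and> h i \<in> T. U $$ (i, k0))"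
  define q where "q = (\<Sum>i | i < n \<and> h i \<notin> T. U $$ (i, k0))"
  obtain a b :: real where ab: "a * p + b * q = 0" "a \<noteq> 0 \<or> b \<noteq> 0"
  proof (cases "p = 0 \<and> q = 0")
    case True
    then show ?thesis using that[of 1 0] by simp
  next
    case False
    then show ?thesis using that[of q "- p"] by auto
  qed
  define c where "c s = (if s \<in> T then a else b)" for s
  define x where "x = vec n (\<lambda>i. c (h i))"
  have x: "x \<in> carrier_vec n" by (simp add: x_def)
  \<comment> \<open>The coordinates of \<open>x\<close> in the eigenbasis. Since the one at
    \<open>k0\<close> vanishes, the quadratic form of \<open>A\<close> at \<open>x\<close> is at
    most \<open>m * (x \<bullet> x)\<close>.\<close>
  define y where "y = U\<^sup>T *\<^sub>v x"
  have y: "y \<in> carrier_vec n" unfolding y_def by (rule mult_mat_vec_carrier[OF UT x])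
  have y0: "y $ k0 = 0"
  proof -
    have "y $ k0 = (\<Sum>i<n. U $$ (i, k0) * c (h i))"
      using k0(2) UD(1) by (simp add: y_def x_def scalar_prod_def atLeast0LessThan)
    also have "\<dots> = (\<Sum>i\<in>{..<n} \<inter> {i. h i \<in> T}. U $$ (i, k0) * a)
        + (\<Sum>i\<in>{..<n} \<inter> - {i. h i \<in> T}. U $$ (i, k0) * b)"
      by (subst sum.If_cases[symmetric]) (auto simp: c_def intro!: sum.cong)
    also have "{..<n} \<inter> {i. h i \<in> T} = {i. i < n \<and> h i \<in> T}" by auto
    also have "{..<n} \<inter> - {i. h i \<in> T} = {i. i < n \<and> h i \<notin> T}" by auto
    also have "(\<Sum>i | i < n \<and> h i \<in> T. U $$ (i, k0) * a)
        + (\<Sum>i | i < n \<and> h i \<notin> T. U $$ (i, k0) * b) = 0"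
      using ab(1) by (simp add: p_def q_def sum_distrib_left mult.commute)
    finally show ?thesis .
  qed
  have Ux: "U *\<^sub>v y = x"
    unfolding y_def using x by (simp add: assoc_mult_mat_vec[OF UD(1) UT, symmetric] UD(4))
  have Ax: "A *\<^sub>v x = U *\<^sub>v (D *\<^sub>v y)"
    unfolding UD(5) y_def using x UD UT
    by (simp add: assoc_mult_mat_vec[of _ n n _ n])
  have move: "x \<bullet> (U *\<^sub>v w) = y \<bullet> w" if "w \<in> carrier_vec n" for w
    using transpose_vec_mult_scalar[OF UD(1) that x] by (simp add: y_def)
  have xx: "x \<bullet> x = (\<Sum>k<n. (y $ k)\<^sup>2)"
    using move[OF y] y by (simp add: Ux scalar_prod_def atLeast0LessThan power2_eq_square)
  have "x \<bullet> (A *\<^sub>v x) = y \<bullet> (D *\<^sub>v y)"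
    using move[of "D *\<^sub>v y"] UD(2) y by (simp add: Ax)
  also have "\<dots> = (\<Sum>k<n. d k * (y $ k)\<^sup>2)"
  proof -
    have "(D *\<^sub>v y) $ k = d k * y $ k" if "k < n" for k
    proof -
      have "(D *\<^sub>v y) $ k = (\<Sum>j<n. D $$ (k, j) * y $ j)"
        using that UD(2) y by (simp add: scalar_prod_def atLeast0LessThan)
      also have "\<dots> = (\<Sum>j<n. if j = k then d k * y $ k else 0)"
        using that UD(2,6) by (intro sum.cong) (auto simp: diagonal_mat_def d_def)
      finally show ?thesis using that by simp
    qed
    then show ?thesis
      using UD(2) y
      by (auto simp: scalar_prod_def atLeast0LessThan power2_eq_square intro!: sum.cong)
  qed
  also have "\<dots> \<le> (\<Sum>k<n. m * (y $ k)\<^sup>2)"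
  proof (intro sum_mono)
    fix k assume "k \<in> {..<n}"
    then show "d k * (y $ k)\<^sup>2 \<le> m * (y $ k)\<^sup>2"
      using k0(1)[of k] y0 by (cases "k = k0") (auto intro: mult_right_mono)
  qed
  finally have upper: "x \<bullet> (A *\<^sub>v x) \<le> m * (x \<bullet> x)"
    by (simp add: xx sum_distrib_left)

  define E where "E = (\<Sum>s\<in>T. \<Sum>t\<in>S - T. pmf (K s) t)"
  have E0: "E \<ge> 0" by (simp add: E_def sum_nonneg)
  have fin: "finite T" using S T finite_subset by blast
  have split: "sum f S = sum f T + sum f (S - T)" for f :: "'a \<Rightarrow> real"
    using S T(1) by (simp add: sum.subset_diff add.commute)
  have xx': "x \<bullet> x = a\<^sup>2 * card T + b\<^sup>2 * card (S - T)"
  proof -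
    have "x \<bullet> x = (\<Sum>i<n. (c (h i))\<^sup>2)"
      by (simp add: x_def scalar_prod_def atLeast0LessThan power2_eq_square)
    also have "\<dots> = (\<Sum>s\<in>S. (c s)\<^sup>2)" by (rule sum.reindex_bij_betw[OF h])
    finally show ?thesis by (simp add: split c_def mult.commute)
  qed
  have "x \<bullet> (A *\<^sub>v x) = (\<Sum>i<n. c (h i) * (\<Sum>j<n. pmf (K (h i)) (h j) * c (h j)))"
    using A by (auto simp: x_def scalar_prod_def atLeast0LessThan Aij intro!: sum.cong)
  also have "\<dots> = (\<Sum>i<n. c (h i) * (\<Sum>t\<in>S. pmf (K (h i)) t * c t))"
    by (intro sum.cong refl arg_cong[of _ _ "(*) _"])
      (rule sum.reindex_bij_betw[OF h, of "\<lambda>t. pmf _ t * c t"])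
  also have "\<dots> = (\<Sum>s\<in>S. c s * (\<Sum>t\<in>S. pmf (K s) t * c t))"
    by (rule sum.reindex_bij_betw[OF h, of "\<lambda>s. c s * (\<Sum>t\<in>S. pmf (K s) t * c t)"])
  \<comment> \<open>Rows sum to one, so averaging \<open>c\<close> over a step changes its value
    only through the probability of crossing the cut.\<close>
  also have "\<dots> = (\<Sum>s\<in>T. a * (a - (a - b) * (\<Sum>t\<in>S - T. pmf (K s) t)))
      + (\<Sum>s\<in>S - T. b * (b + (a - b) * (\<Sum>t\<in>T. pmf (K s) t)))"
  proof -
    have row: "(\<Sum>t\<in>T. pmf (K s) t) + (\<Sum>t\<in>S - T. pmf (K s) t) = 1" if "s \<in> S" for s
      using sum_pmf_eq_1[OF S supp[OF that]] by (simp add: split)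
    have "(\<Sum>t\<in>S. pmf (K s) t * c t)
        = a * (\<Sum>t\<in>T. pmf (K s) t) + b * (\<Sum>t\<in>S - T. pmf (K s) t)" for s
      by (simp add: split c_def sum_distrib_left mult.commute)
    moreover have "a * u + b * v = a - (a - b) * v" "a * u + b * v = b + (a - b) * u"
      if "u + v = 1" for u v :: real
      by (simp_all add: eq_diff_eq[THEN iffD2, OF that] algebra_simps)
    ultimately have
      "(\<Sum>t\<in>S. pmf (K s) t * c t) = a - (a - b) * (\<Sum>t\<in>S - T. pmf (K s) t)"
      "(\<Sum>t\<in>S. pmf (K s) t * c t) = b + (a - b) * (\<Sum>t\<in>T. pmf (K s) t)" if "s \<in> S" for s
      using row[OF that] by metis+
    note this[symmetric]
    moreover have "s \<in> S" if "s \<in> T" for s using that T(1) by auto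
    ultimately have
      "(\<Sum>s\<in>T. a * (a - (a - b) * (\<Sum>t\<in>S - T. pmf (K s) t)))
        = (\<Sum>s\<in>T. c s * (\<Sum>t\<in>S. pmf (K s) t * c t))"
      "(\<Sum>s\<in>S - T. b * (b + (a - b) * (\<Sum>t\<in>T. pmf (K s) t)))
        = (\<Sum>s\<in>S - T. c s * (\<Sum>t\<in>S. pmf (K s) t * c t))"
      by (intro sum.cong refl arg_cong2[of _ _ _ _ "(*)"]; simp add: c_def)+
    then show ?thesis by (simp only: split[of "\<lambda>s. c s * (\<Sum>t\<in>S. pmf (K s) t * c t)"])
  qed
  also have "\<dots> = x \<bullet> x - a * (a - b) * E + b * (a - b) * (\<Sum>s\<in>S - T. \<Sum>t\<in>T. pmf (K s) t)"
    by (simp add: xx' E_def algebra_simps sum.distrib sum_subtractf sum_distrib_left power2_eq_square)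
  \<comment> \<open>By symmetry of the matrix the flow back across the cut equals the flow out of
    \<open>T\<close>.\<close>
  also have "(\<Sum>s\<in>S - T. \<Sum>t\<in>T. pmf (K s) t) = E"
    unfolding E_def by (subst sum.swap) (use T(1) in \<open>auto intro!: sum.cong sym\<close>)
  finally have lower: "x \<bullet> (A *\<^sub>v x) = x \<bullet> x - (a - b)\<^sup>2 * E"
    by (simp add: algebra_simps power2_eq_square)
  from upper lower have key: "(1 - m) * (x \<bullet> x) \<le> (a - b)\<^sup>2 * E"
    by (simp add: algebra_simps)
  define r where "r = real (card T)"
  define r' where "r' = real (card (S - T))"
  have r: "r > 0" "r' > 0" "real (card S) = r + r'"
  proof -
    have "S - T \<noteq> {}" using T by blast
    then show "r > 0" "r' > 0" using S T fin by (simp_all add: r_def r'_def card_gt_0_iff)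
    show "real (card S) = r + r'" using split[of "\<lambda>_. 1"] by (simp add: r_def r'_def)
  qed
  have "(1 - m) * (r * r') \<le> (r + r') * E"
  proof (cases "1 - m \<le> 0")
    case True
    then have "(1 - m) * (r * r') \<le> 0" using r by (simp add: mult_nonpos_nonneg)
    also have "0 \<le> (r + r') * E" using r E0 by simp
    finally show ?thesis .
  next
    case False
    have xx'': "x \<bullet> x = a\<^sup>2 * r + b\<^sup>2 * r'" by (simp add: xx' r_def r'_def)
    have "x \<bullet> x > 0"
      using ab(2) r unfolding xx'' by (auto intro: add_pos_nonneg add_nonneg_pos)
    \<comment> \<open>For \<open>a = b\<close> the inequality \<open>key\<close> would make a
      positive number at most \<open>0\<close>.\<close>
    then have "a \<noteq> b" using key False by (auto simp: mult_le_0_iff)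
    then have pos: "(a - b)\<^sup>2 > 0" by simp
    \<comment> \<open>Nothing is known about the sizes of \<open>a\<close> and \<open>b\<close>. The
      square on the right bounds \<open>x \<bullet> x\<close> from below by a multiple of
      \<open>(a - b)^2\<close>, which then cancels against the same factor in
      \<open>key\<close>.\<close>
    have "(r + r') * (a\<^sup>2 * r + b\<^sup>2 * r') - (a - b)\<^sup>2 * (r * r') = (a * r + b * r')\<^sup>2"
      by (simp add: power2_eq_square algebra_simps)
    then have "(a - b)\<^sup>2 * (r * r') \<le> (r + r') * (x \<bullet> x)"
      unfolding xx'' by (metis diff_ge_0_iff_ge zero_le_power2)
    then have "(1 - m) * ((a - b)\<^sup>2 * (r * r')) \<le> (1 - m) * ((r + r') * (x \<bullet> x))"
      using False by (intro mult_left_mono) auto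
    also have "\<dots> = (r + r') * ((1 - m) * (x \<bullet> x))" by simp
    also have "\<dots> \<le> (r + r') * ((a - b)\<^sup>2 * E)"
      using key r by (intro mult_left_mono) auto
    finally have "(a - b)\<^sup>2 * ((1 - m) * (r * r')) \<le> (a - b)\<^sup>2 * ((r + r') * E)"
      by (simp add: mult_ac)
    then show ?thesis using pos by simp
  qed
  then show ?thesis using r by (simp add: gap r_def r'_def E_def)
qed

section \<open>The down-up walk for a uniform distribution\<close>

text \<open>Removing \<open>\<tau>\<close> is an order isomorphism from the faces containing
  \<open>\<tau>\<close> onto the link, and all faces above such a face contain \<open>\<tau>\<close>
  too, so maximality means the same on both sides.\<close>

lemma facets_link:
  "facets (link X \<tau>) = (\<lambda>\<sigma>. \<sigma> - \<tau>) ` {\<sigma> \<in> facets X. \<tau> \<subseteq> \<sigma>}"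
proof (rule Set.set_eqI)
  fix \<rho>
  have max_iff: "(\<forall>\<sigma>' \<in> X. \<sigma> \<subseteq> \<sigma>' \<longrightarrow> \<sigma>' = \<sigma>)
      \<longleftrightarrow> (\<forall>\<rho>' \<in> link X \<tau>. \<sigma> - \<tau> \<subseteq> \<rho>' \<longrightarrow> \<rho>' = \<sigma> - \<tau>)" if "\<tau> \<subseteq> \<sigma>" for \<sigma>
  proof -
    have "(\<forall>\<rho>' \<in> link X \<tau>. \<sigma> - \<tau> \<subseteq> \<rho>' \<longrightarrow> \<rho>' = \<sigma> - \<tau>)
        \<longleftrightarrow> (\<forall>\<sigma>' \<in> X. \<tau> \<subseteq> \<sigma>' \<longrightarrow> \<sigma> - \<tau> \<subseteq> \<sigma>' - \<tau> \<longrightarrow> \<sigma>' - \<tau> = \<sigma> - \<tau>)"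
      unfolding link_def by auto
    also have "\<dots> \<longleftrightarrow> (\<forall>\<sigma>' \<in> X. \<sigma> \<subseteq> \<sigma>' \<longrightarrow> \<sigma>' = \<sigma>)"
    proof (rule ball_cong[OF refl])
      fix \<sigma>' 
      show "(\<tau> \<subseteq> \<sigma>' \<longrightarrow> \<sigma> - \<tau> \<subseteq> \<sigma>' - \<tau> \<longrightarrow> \<sigma>' - \<tau> = \<sigma> - \<tau>)
          \<longleftrightarrow> (\<sigma> \<subseteq> \<sigma>' \<longrightarrow> \<sigma>' = \<sigma>)"
        using that by blast
    qed
    finally show ?thesis ..
  qed
  have "\<rho> \<in> facets (link X \<tau>) \<longleftrightarrow> (\<exists>\<sigma> \<in> X. \<tau> \<subseteq> \<sigma> \<and> \<rho> = \<sigma> - \<tau>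
      \<and> (\<forall>\<rho>' \<in> link X \<tau>. \<sigma> - \<tau> \<subseteq> \<rho>' \<longrightarrow> \<rho>' = \<sigma> - \<tau>))"
    unfolding facets_def by (auto simp: link_def)
  also have "\<dots> \<longleftrightarrow> (\<exists>\<sigma> \<in> X. \<tau> \<subseteq> \<sigma> \<and> \<rho> = \<sigma> - \<tau> \<and> (\<forall>\<sigma>' \<in> X. \<sigma> \<subseteq> \<sigma>' \<longrightarrow> \<sigma>' = \<sigma>))"
    by (intro bex_cong conj_cong refl max_iff[symmetric])
  finally show "\<rho> \<in> facets (link X \<tau>) \<longleftrightarrow> \<rho> \<in> (\<lambda>\<sigma>. \<sigma> - \<tau>) ` {\<sigma> \<in> facets X. \<tau> \<subseteq> \<sigma>}"
    by (auto simp: facets_def)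
qed

lemma cond_pmf_of_set:
  assumes "finite A" and "A \<inter> B \<noteq> {}"
  shows "cond_pmf (pmf_of_set A) B = pmf_of_set (A \<inter> B)"
proof (rule pmf_eqI)
  fix x
  have A: "A \<noteq> {}" using assms by auto
  have "set_pmf (pmf_of_set A) \<inter> B \<noteq> {}"
    using assms by (simp add: set_pmf_of_set[OF A assms(1)])
  with A show "pmf (cond_pmf (pmf_of_set A) B) x = pmf (pmf_of_set (A \<inter> B)) x"
    using assms by (simp add: pmf_cond measure_pmf_of_set indicator_def)
qed

text \<open>Conditioning a uniform distribution keeps it uniform, and removal of
  \<open>\<tau>\<close> is injective on facets containing it.\<close>

lemma link_pmf_uniform:
  assumes "finite X" and "facets (link X \<tau>) \<noteq> {}"
  shows "link_pmf (pmf_of_set (facets X)) \<tau> = pmf_of_set (facets (link X \<tau>))"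
proof -
  have fin: "finite (facets X)" using assms(1) by (auto simp: facets_def)
  have eq: "facets X \<inter> {\<sigma>. \<tau> \<subseteq> \<sigma>} = {\<sigma> \<in> facets X. \<tau> \<subseteq> \<sigma>}" by auto
  have ne: "{\<sigma> \<in> facets X. \<tau> \<subseteq> \<sigma>} \<noteq> {}" using assms(2) by (auto simp: facets_link)
  have "cond_pmf (pmf_of_set (facets X)) {\<sigma>. \<tau> \<subseteq> \<sigma>} = pmf_of_set {\<sigma> \<in> facets X. \<tau> \<subseteq> \<sigma>}"
    using ne fin by (subst cond_pmf_of_set) (auto simp: eq)
  moreover have "inj_on (\<lambda>\<sigma>. \<sigma> - \<tau>) {\<sigma> \<in> facets X. \<tau> \<subseteq> \<sigma>}"
    by (rule inj_onI) blast
  ultimately show ?thesis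
    using ne fin by (simp add: link_pmf_def facets_link map_pmf_of_set_inj)
qed

section \<open>Symmetry of the down-up walk on a pure complex\<close>

locale pure_facets =
  fixes Y :: "'a set set" and m :: nat
  assumes fin: "finite Y" and card: "\<sigma> \<in> Y \<Longrightarrow> card \<sigma> = m" and m: "m > 0"
begin

lemma finite_facet: "\<sigma> \<in> Y \<Longrightarrow> finite \<sigma>"
  using card m card.infinite by fastforce

text \<open>Summing over the common subsets \<open>\<eta>\<close> of size \<open>m - 1\<close>
  instead of over the deleted element makes the expression symmetric in \<open>\<sigma>\<close> and
  \<open>\<rho>\<close>. Equal cardinality of the facets is what makes \<open>\<eta>\<close> a
  one-element deletion of either of them.\<close>

lemma pmf_down_up:
  assumes \<sigma>: "\<sigma> \<in> Y" and \<rho>: "\<rho> \<in> Y"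
  shows "pmf (down_up (pmf_of_set Y) \<sigma>) \<rho> =
    (\<Sum>\<eta> | \<eta> \<subseteq> \<sigma> \<inter> \<rho> \<and> card \<eta> = m - 1. 1 / card {\<sigma>' \<in> Y. \<eta> \<subseteq> \<sigma>'}) / m"
proof -
  have f\<sigma>: "finite \<sigma>" and ne: "\<sigma> \<noteq> {}"
    using finite_facet[OF \<sigma>] card[OF \<sigma>] m by auto
  have "pmf (down_up (pmf_of_set Y) \<sigma>) \<rho>
      = (\<Sum>x\<in>\<sigma>. pmf (cond_pmf (pmf_of_set Y) {\<sigma>'. \<sigma> - {x} \<subseteq> \<sigma>'}) \<rho>) / m"
    unfolding down_up_def using f\<sigma> ne card[OF \<sigma>] by (simp add: pmf_bind_pmf_of_set)
  also have "(\<Sum>x\<in>\<sigma>. pmf (cond_pmf (pmf_of_set Y) {\<sigma>'. \<sigma> - {x} \<subseteq> \<sigma>'}) \<rho>)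
      = (\<Sum>x\<in>\<sigma>. if \<sigma> - {x} \<subseteq> \<rho> then 1 / card {\<sigma>' \<in> Y. \<sigma> - {x} \<subseteq> \<sigma>'} else 0)"
  proof (rule sum.cong[OF refl])
    fix x assume "x \<in> \<sigma>"
    have eq: "Y \<inter> {\<sigma>'. \<sigma> - {x} \<subseteq> \<sigma>'} = {\<sigma>' \<in> Y. \<sigma> - {x} \<subseteq> \<sigma>'}" by auto
    have ne: "{\<sigma>' \<in> Y. \<sigma> - {x} \<subseteq> \<sigma>'} \<noteq> {}" using \<sigma> by auto
    have "cond_pmf (pmf_of_set Y) {\<sigma>'. \<sigma> - {x} \<subseteq> \<sigma>'} = pmf_of_set {\<sigma>' \<in> Y. \<sigma> - {x} \<subseteq> \<sigma>'}"
      using fin ne by (subst cond_pmf_of_set) (auto simp: eq)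
    then show "pmf (cond_pmf (pmf_of_set Y) {\<sigma>'. \<sigma> - {x} \<subseteq> \<sigma>'}) \<rho>
        = (if \<sigma> - {x} \<subseteq> \<rho> then 1 / card {\<sigma>' \<in> Y. \<sigma> - {x} \<subseteq> \<sigma>'} else 0)"
      using fin ne \<rho> by (simp add: indicator_def)
  qed
  also have "\<dots> = (\<Sum>x | x \<in> \<sigma> \<and> \<sigma> - {x} \<subseteq> \<rho>. 1 / card {\<sigma>' \<in> Y. \<sigma> - {x} \<subseteq> \<sigma>'})"
    using f\<sigma> by (simp add: sum.inter_filter)
  also have "\<dots> = (\<Sum>\<eta> | \<eta> \<subseteq> \<sigma> \<inter> \<rho> \<and> card \<eta> = m - 1. 1 / card {\<sigma>' \<in> Y. \<eta> \<subseteq> \<sigma>'})"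
  proof (rule sum.reindex_bij_betw[of "\<lambda>x. \<sigma> - {x}"])
    show "bij_betw (\<lambda>x. \<sigma> - {x}) {x \<in> \<sigma>. \<sigma> - {x} \<subseteq> \<rho>} {\<eta>. \<eta> \<subseteq> \<sigma> \<inter> \<rho> \<and> card \<eta> = m - 1}"
      unfolding bij_betw_def
    proof (intro conjI equalityI subsetI inj_onI)
      fix \<eta> assume \<eta>: "\<eta> \<in> {\<eta>. \<eta> \<subseteq> \<sigma> \<inter> \<rho> \<and> card \<eta> = m - 1}"
      then have "finite \<eta>" using f\<sigma> finite_subset by blast
      with \<eta> have "card (\<sigma> - \<eta>) = 1"
        using card[OF \<sigma>] m by (simp add: card_Diff_subset)
      then obtain x where "\<sigma> - \<eta> = {x}" by (auto simp: card_1_singleton_iff)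
      then show "\<eta> \<in> (\<lambda>x. \<sigma> - {x}) ` {x \<in> \<sigma>. \<sigma> - {x} \<subseteq> \<rho>}"
        using \<eta> by (intro image_eqI[of _ _ x]) auto
    qed (use f\<sigma> card[OF \<sigma>] in auto)
  qed
  finally show ?thesis .
qed

lemma pmf_down_up_commute:
  "\<sigma> \<in> Y \<Longrightarrow> \<rho> \<in> Y \<Longrightarrow> pmf (down_up (pmf_of_set Y) \<sigma>) \<rho> = pmf (down_up (pmf_of_set Y) \<rho>) \<sigma>"
  unfolding pmf_down_up[of \<sigma> \<rho>] pmf_down_up[of \<rho> \<sigma>] by (subst Int_commute) (rule refl)

lemma set_pmf_down_up:
  assumes \<sigma>: "\<sigma> \<in> Y"
  shows "set_pmf (down_up (pmf_of_set Y) \<sigma>) \<subseteq> {\<rho> \<in> Y. \<exists>x\<in>\<sigma>. \<sigma> - {x} \<subseteq> \<rho>}"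
proof -
  have f\<sigma>: "finite \<sigma>" and ne: "\<sigma> \<noteq> {}"
    using finite_facet[OF \<sigma>] card[OF \<sigma>] m by auto
  have "set_pmf (cond_pmf (pmf_of_set Y) {\<sigma>'. \<sigma> - {x} \<subseteq> \<sigma>'}) = Y \<inter> {\<sigma>'. \<sigma> - {x} \<subseteq> \<sigma>'}" for x
  proof -
    have ne: "Y \<inter> {\<sigma>'. \<sigma> - {x} \<subseteq> \<sigma>'} \<noteq> {}" using \<sigma> by auto
    show ?thesis
      unfolding cond_pmf_of_set[OF fin ne] using fin by (intro set_pmf_of_set[OF ne]) auto
  qed
  then show ?thesis
    unfolding down_up_def using f\<sigma> ne by auto
qed

lemma pmf_down_up_eq_0:
  assumes "\<sigma> \<in> Y" and "\<And>x. x \<in> \<sigma> \<Longrightarrow> \<not> \<sigma> - {x} \<subseteq> \<rho>"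
  shows "pmf (down_up (pmf_of_set Y) \<sigma>) \<rho> = 0"
  using set_pmf_down_up[OF assms(1)] assms(2) by (auto simp: set_pmf_iff)

end

section \<open>Forests and graphic broken circuits\<close>

definition conn :: "'v set set \<Rightarrow> 'v rel" where
  "conn F = {(u, v). {u, v} \<in> F}\<^sup>*"

lemma conn_refl [simp]: "(u, u) \<in> conn F"
  by (simp add: conn_def)

lemma conn_edge: "{u, v} \<in> F \<Longrightarrow> (u, v) \<in> conn F"
  by (auto simp: conn_def)

lemma conn_trans: "(u, v) \<in> conn F \<Longrightarrow> (v, w) \<in> conn F \<Longrightarrow> (u, w) \<in> conn F"
  unfolding conn_def by (rule rtrancl_trans)

lemma conn_sym: "(u, v) \<in> conn F \<Longrightarrow> (v, u) \<in> conn F"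
proof -
  have "sym {(u, v). {u, v} \<in> F}" by (auto simp: sym_def insert_commute)
  then have "sym (conn F)" unfolding conn_def by (rule sym_rtrancl)
  then show "(u, v) \<in> conn F \<Longrightarrow> (v, u) \<in> conn F" by (rule symD)
qed

lemma conn_mono: "F \<subseteq> F' \<Longrightarrow> conn F \<subseteq> conn F'"
  unfolding conn_def by (rule rtrancl_mono) auto

lemma conn_subset:
  assumes "\<And>u v. {u, v} \<in> F \<Longrightarrow> (u, v) \<in> conn F'"
  shows "conn F \<subseteq> conn F'"
proof
  fix p assume "p \<in> conn F"
  then obtain u v where p: "p = (u, v)" "(u, v) \<in> {(u, v). {u, v} \<in> F}\<^sup>*"
    by (cases p) (auto simp: conn_def)
  from p(2) have "(u, v) \<in> conn F'"
    by (induction rule: rtrancl_induct) (simp_all, metis assms conn_trans)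
  then show "p \<in> conn F'" using p by simp
qed

text \<open>The way to refute connectivity: a labelling that is constant along edges but differs at
  the two vertices.\<close>

lemma conn_invariant:
  assumes "(u, v) \<in> conn F" and "\<And>u v. {u, v} \<in> F \<Longrightarrow> f u = f v"
  shows "f u = f v"
  using assms(1) unfolding conn_def
  by (induction rule: rtrancl_induct) (auto dest: assms(2))

text \<open>A walk can be shortened until it uses the new edge at most once, in one of its two
  directions.\<close>

lemma conn_insert:
  assumes "(x, y) \<in> conn (insert {u, v} F)"
  shows "(x, y) \<in> conn F \<or> (x, u) \<in> conn F \<and> (v, y) \<in> conn F \<or> (x, v) \<in> conn F \<and> (u, y) \<in> conn F"
  using assms unfolding conn_def[of "insert _ _"]
proof (induction rule: rtrancl_induct)
  case (step y z)
  then have "{y, z} \<in> F \<or> y = u \<and> z = v \<or> y = v \<and> z = u" by (auto simp: doubleton_eq_iff)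
  with step.IH show ?case
    by (metis conn_edge conn_refl conn_trans)
qed simp

lemma conn_imp_path:
  assumes "(u, v) \<in> conn F"
  obtains vs where "vs \<noteq> []" "hd vs = u" "last vs = v" "distinct vs"
    "\<And>i. Suc i < length vs \<Longrightarrow> {vs ! i, vs ! Suc i} \<in> F"
proof -
  have "\<exists>vs. vs \<noteq> [] \<and> hd vs = u \<and> last vs = v \<and> distinct vs
      \<and> (\<forall>i. Suc i < length vs \<longrightarrow> {vs ! i, vs ! Suc i} \<in> F)"
    using assms unfolding conn_def
  proof (induction rule: rtrancl_induct)
    case base
    show ?case by (intro exI[of _ "[u]"]) auto
  next
    case (step y z)
    then obtain vs where vs: "vs \<noteq> []" "hd vs = u" "last vs = y" "distinct vs"
      "\<And>i. Suc i < length vs \<Longrightarrow> {vs ! i, vs ! Suc i} \<in> F" by blast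
    show ?case
    proof (cases "z \<in> set vs")
      case True
      \<comment> \<open>The walk returns to a vertex of the path; cutting the list there keeps its
        vertices distinct.\<close>
      then obtain k where k: "k < length vs" "vs ! k = z" by (auto simp: in_set_conv_nth)
      define ws where "ws = take (Suc k) vs"
      have ws: "length ws = Suc k" "\<And>i. i \<le> k \<Longrightarrow> ws ! i = vs ! i"
        using k(1) by (auto simp: ws_def)
      then have "ws \<noteq> []" by auto
      with ws k vs(1,2) have "hd ws = u" "last ws = z"
        by (simp_all add: hd_conv_nth last_conv_nth)
      moreover have "distinct ws" using vs(4) by (simp add: ws_def)
      moreover have "{ws ! i, ws ! Suc i} \<in> F" if "Suc i < length ws" for i
        using that ws vs(5)[of i] k(1) by simp
      ultimately show ?thesis using \<open>ws \<noteq> []\<close> by blast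
    next
      case False
      have "{(vs @ [z]) ! i, (vs @ [z]) ! Suc i} \<in> F" if "Suc i < length (vs @ [z])" for i
      proof (cases "Suc i < length vs")
        case True
        then show ?thesis using vs(5) by (simp add: nth_append)
      next
        case False
        with that have i: "Suc i = length vs" by simp
        then have "vs ! i = y" using vs(1,3) by (metis diff_Suc_1 last_conv_nth)
        then show ?thesis using i step.hyps(2) by (simp add: nth_append)
      qed
      then show ?thesis
        using vs(1-4) False by (intro exI[of _ "vs @ [z]"]) auto
    qed
  qed
  then show ?thesis using that by blast
qed

section \<open>Cycles, forests and components\<close>

lemma acyclic_edges_subset: "acyclic_edges F \<Longrightarrow> F' \<subseteq> F \<Longrightarrow> acyclic_edges F'"
  unfolding acyclic_edges_def graph_cycle_def by (meson subsetD)

lemma acyclic_insert_imp_not_conn: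
  assumes "acyclic_edges (insert {u, v} F)" and "{u, v} \<notin> F" and "u \<noteq> v"
  shows "(u, v) \<notin> conn F"
proof
  assume "(u, v) \<in> conn F"
  then obtain vs where vs: "vs \<noteq> []" "hd vs = u" "last vs = v" "distinct vs"
    "\<And>i. Suc i < length vs \<Longrightarrow> {vs ! i, vs ! Suc i} \<in> F"
    by (rule conn_imp_path) blast
  have ends: "vs ! 0 = u" "vs ! (length vs - 1) = v"
    using vs(1-3) by (auto simp: hd_conv_nth last_conv_nth)
  have "length vs \<noteq> 1" using ends assms(3) by auto
  \<comment> \<open>A path on two vertices would be the edge \<open>{u, v}\<close> itself, which
    \<open>F\<close> does not contain. Hence the closed path has the three vertices that
    \<open>graph_cycle\<close> demands.\<close>
  moreover have "length vs \<noteq> 2"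
  proof
    assume "length vs = 2"
    with vs(5)[of 0] ends assms(2) show False by simp
  qed
  ultimately have "3 \<le> length vs" using vs(1) by (cases vs; cases "tl vs"; cases "tl (tl vs)") auto
  moreover have "{vs ! i, vs ! (Suc i mod length vs)} \<in> insert {u, v} F" if "i < length vs" for i
  proof (cases "Suc i < length vs")
    case True
    then show ?thesis using vs(5) by simp
  next
    case False
    with that have "Suc i = length vs" by simp
    then have "i = length vs - 1" "Suc i mod length vs = 0" by auto
    then show ?thesis using ends by auto
  qed
  ultimately have "graph_cycle (insert {u, v} F) vs"
    using vs(4) by (simp add: graph_cycle_def)
  with assms(1) show False by (auto simp: acyclic_edges_def)
qed

text \<open>A new cycle must use \<open>{u, v}\<close>, and its remainder, the long way round,
  connects the two ends in \<open>F\<close>. What needs proof is that the remainder avoids the new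
  edge.\<close>

lemma not_conn_imp_acyclic_insert:
  assumes F: "acyclic_edges F" and nc: "(u, v) \<notin> conn F"
  shows "acyclic_edges (insert {u, v} F)"
  unfolding acyclic_edges_def
proof
  assume "\<exists>vs. graph_cycle (insert {u, v} F) vs"
  then obtain vs where vs: "3 \<le> length vs" "distinct vs"
    and edge: "\<And>i. i < length vs \<Longrightarrow> {vs ! i, vs ! (Suc i mod length vs)} \<in> insert {u, v} F"
    unfolding graph_cycle_def by blast
  define n where "n = length vs"
  have n: "n \<ge> 3" using vs by (simp add: n_def)
  define e where "e i = {vs ! (i mod n), vs ! (Suc i mod n)}" for i
  have inj: "vs ! (i mod n) = vs ! (j mod n) \<longleftrightarrow> i mod n = j mod n" for i j
    using vs(2) n by (simp add: nth_eq_iff_index_eq n_def[symmetric])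
  obtain i where i: "i < n" "e i \<notin> F"
  proof -
    have "\<not> graph_cycle F vs" using F by (auto simp: acyclic_edges_def)
    then show ?thesis
      using that vs n unfolding graph_cycle_def n_def[symmetric] e_def by auto
  qed
  have eF: "e j \<in> insert {u, v} F" for j
    using edge[of "j mod n"] n by (simp add: e_def n_def[symmetric] mod_Suc_eq)
  then have ei: "e i = {u, v}" using i by auto
  \<comment> \<open>A second occurrence of the edge has either the same position, or the ends
    swapped. In the latter case \<open>n\<close> divides both \<open>k\<close> and
    \<open>k + 2\<close>, hence \<open>2\<close>.\<close>
  have other: "e (i + Suc k) \<in> F" if "Suc k < n" for k
  proof (rule ccontr)
    assume "e (i + Suc k) \<notin> F"
    then have "e (i + Suc k) = e i" using eF ei by auto
    then have "i mod n = (i + Suc k) mod n \<or>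
        i mod n = Suc (i + Suc k) mod n \<and> Suc i mod n = (i + Suc k) mod n"
      unfolding e_def doubleton_eq_iff inj by auto
    moreover have dvd: "n dvd l" if "(j + l) mod n = j mod n" for j l
      using that by (simp add: mod_eq_dvd_iff_nat)
    have "i mod n \<noteq> (i + Suc k) mod n"
      using dvd[of i "Suc k"] dvd_imp_le[of n "Suc k"] \<open>Suc k < n\<close> by force
    ultimately have "(i + Suc (Suc k)) mod n = i mod n" "(Suc i + k) mod n = Suc i mod n"
      by simp_all
    then have "n dvd Suc (Suc k)" "n dvd k"
      using dvd[of i "Suc (Suc k)"] dvd[of "Suc i" k] by blast+
    then have "n dvd Suc (Suc k) - k" by (rule dvd_diff_nat)
    then have "n dvd 2" by simp
    then show False using n by (auto dest: dvd_imp_le)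
  qed
  have path: "(vs ! (Suc i mod n), vs ! ((i + Suc k) mod n)) \<in> conn F" if "k < n" for k
    using that
  proof (induction k)
    case (Suc k)
    have "{vs ! ((i + Suc k) mod n), vs ! ((i + Suc (Suc k)) mod n)} \<in> F"
      using other[of k] Suc.prems by (simp add: e_def)
    then show ?case using Suc by (intro conn_trans[OF Suc.IH conn_edge]) auto
  qed simp
  have "(i + Suc (n - 1)) mod n = i mod n" using n by simp
  then have "(vs ! (Suc i mod n), vs ! (i mod n)) \<in> conn F"
    using path[of "n - 1"] n by simp
  then have "(u, v) \<in> conn F"
    using ei unfolding e_def doubleton_eq_iff by (metis conn_sym)
  with nc show False ..
qed

text \<open>If every edge joins a vertex to its parent of smaller height, then both neighbours
  on a cycle of a highest vertex are its parent.\<close>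

lemma acyclic_edges_parent:
  fixes h :: "'v \<Rightarrow> nat"
  assumes "\<And>e. e \<in> F \<Longrightarrow> \<exists>v. e = {v, p v} \<and> h (p v) < h v"
  shows "acyclic_edges F"
  unfolding acyclic_edges_def
proof
  assume "\<exists>vs. graph_cycle F vs"
  then obtain vs where vs: "3 \<le> length vs" "distinct vs"
    and edge: "\<And>i. i < length vs \<Longrightarrow> {vs ! i, vs ! (Suc i mod length vs)} \<in> F"
    unfolding graph_cycle_def by blast
  define n where "n = length vs"
  have n: "n \<ge> 3" using vs by (simp add: n_def)
  have fin: "finite (h ` set vs)" "h ` set vs \<noteq> {}" using vs by auto
  obtain x where x: "x \<in> set vs" "h x = Max (h ` set vs)"
    using Max_in[OF fin] by auto
  then have max: "h y \<le> h x" if "y \<in> set vs" for y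
    using that by (simp add: x(2))
  obtain i where i: "i < n" "vs ! i = x" using x(1) by (auto simp: in_set_conv_nth n_def)
  have up: "y = p x" if "{x, y} \<in> F" "y \<in> set vs" for y
    using assms[OF that(1)] max[OF that(2)] by (auto simp: doubleton_eq_iff)
  \<comment> \<open>The cyclic predecessor of \<open>i\<close>; adding \<open>n - 1\<close> avoids
    truncated subtraction at \<open>i = 0\<close>. If both neighbours of \<open>x\<close> are
    \<open>p x\<close>, going two steps round the cycle returns to \<open>i\<close>, so
    \<open>n\<close> divides \<open>2\<close>.\<close>
  define j where "j = (i + (n - 1)) mod n"
  have j: "j < n" "Suc j mod n = i"
    using n i by (auto simp: j_def mod_Suc_eq)
  have k: "Suc i mod n < n" using n by simp
  have "vs ! (Suc i mod n) = p x"
    using edge[of i] i k by (intro up) (auto simp: n_def)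
  moreover have "vs ! j = p x"
    using edge[of j] i j by (intro up) (auto simp: n_def insert_commute)
  ultimately have "Suc i mod n = j"
    using vs(2) j k by (metis n_def nth_eq_iff_index_eq)
  then have "(i + 2) mod n = i mod n"
    using j(2) i(1) by (simp add: mod_Suc_eq flip: \<open>Suc i mod n = j\<close>)
  then have "n dvd 2" by (simp add: mod_eq_dvd_iff_nat)
  then show False using n by (auto dest: dvd_imp_le)
qed

text \<open>The labelling stands in for the quotient by \<open>conn F\<close>: a further forest edge
  merges two classes by relabelling one, which lowers the number of labels on \<open>V\<close> by
  one.\<close>

lemma forest_component_labelling:
  fixes V :: "'v set"
  assumes "finite F" and "acyclic_edges F" and "finite V"
    and "\<And>e. e \<in> F \<Longrightarrow> e \<subseteq> V \<and> card e = 2"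
  shows "\<exists>f :: 'v \<Rightarrow> 'v. (\<forall>u v. (u, v) \<in> conn F \<longleftrightarrow> f u = f v) \<and> card (f ` V) + card F = card V"
  using assms
proof (induction F rule: finite_induct)
  case empty
  have "(u, v) \<in> conn {} \<longleftrightarrow> u = v" for u v :: 'v
    by (simp add: conn_def)
  then show ?case by (intro exI[of _ "\<lambda>x. x"]) simp
next
  case (insert e F)
  have "acyclic_edges F"
    using insert.prems(1) by (rule acyclic_edges_subset) auto
  then obtain f :: "'v \<Rightarrow> 'v" where f: "\<And>u v. (u, v) \<in> conn F \<longleftrightarrow> f u = f v"
      "card (f ` V) + card F = card V"
    using insert.IH insert.prems by auto
  have "e \<subseteq> V" "card e = 2" using insert.prems(3) by auto
  then obtain u v where uv: "e = {u, v}" "u \<noteq> v" "u \<in> V" "v \<in> V"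
    by (auto simp: card_2_iff)
  then have "(u, v) \<notin> conn F"
    using acyclic_insert_imp_not_conn[of u v F] insert.prems(1) insert.hyps(2) by auto
  then have ne: "f u \<noteq> f v" using f(1) by simp
  define g where "g w = (if f w = f v then f u else f w)" for w
  have g_iff: "(x, y) \<in> conn (insert e F) \<longleftrightarrow> g x = g y" for x y
  proof
    assume "(x, y) \<in> conn (insert e F)"
    then show "g x = g y"
      using conn_insert[of x y u v F] unfolding uv(1) f(1) g_def by auto
  next
    assume "g x = g y"
    then have "f x = f y \<or> f x = f u \<and> f v = f y \<or> f x = f v \<and> f u = f y"
      using ne by (auto simp: g_def split: if_splits)
    then have "(x, y) \<in> conn F \<or> (x, u) \<in> conn F \<and> (v, y) \<in> conn F
        \<or> (x, v) \<in> conn F \<and> (u, y) \<in> conn F"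
      by (simp add: f(1))
    moreover have "conn F \<subseteq> conn (insert e F)" by (rule conn_mono) auto
    moreover have "(u, v) \<in> conn (insert e F)" "(v, u) \<in> conn (insert e F)"
      by (auto intro!: conn_edge simp: uv insert_commute)
    ultimately show "(x, y) \<in> conn (insert e F)" by (meson conn_trans subsetD)
  qed
  have "g ` V = f ` V - {f v}"
    using uv ne by (auto simp: g_def image_iff split: if_splits)
  moreover have "f v \<in> f ` V" using uv by simp
  ultimately have "card (g ` V) + 1 = card (f ` V)"
    using insert.prems(2) by (metis Suc_eq_plus1 card_Suc_Diff1 finite_imageI)
  then have "card (g ` V) + card (insert e F) = card V"
    using f(2) insert.hyps by simp
  then show ?case using g_iff by blast
qed

lemma card_spanning_tree:
  fixes V :: "'v set"
  assumes "finite V" "V \<noteq> {}" and "acyclic_edges F"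
    and "\<And>e. e \<in> F \<Longrightarrow> e \<subseteq> V \<and> card e = 2"
    and "\<And>u v. u \<in> V \<Longrightarrow> v \<in> V \<Longrightarrow> (u, v) \<in> conn F"
  shows "card F + 1 = card V"
proof -
  have "finite F"
    by (rule finite_subset[of _ "Pow V"]) (use assms(1,4) in auto)
  from forest_component_labelling[OF this assms(3,1,4)]
  obtain f :: "'v \<Rightarrow> 'v" where f: "\<And>u v. (u, v) \<in> conn F \<longleftrightarrow> f u = f v"
      "card (f ` V) + card F = card V"
    by blast
  obtain w where w: "w \<in> V" using assms(2) by auto
  have "f ` V = {f w}" using f(1) assms(5) w by blast
  then show ?thesis using f(2) by simp
qed

section \<open>Circuits and broken circuits of graphic matroids\<close>

lemma circuit_conn:
  assumes C: "C \<in> circuits (graphic_matroid E)" and e: "{u, v} \<in> C"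
  shows "(u, v) \<in> conn (C - {{u, v}})"
proof (rule ccontr)
  assume nc: "(u, v) \<notin> conn (C - {{u, v}})"
  have "C - {{u, v}} \<in> indep (graphic_matroid E)"
    using C e unfolding circuits_def by blast
  then have "acyclic_edges (C - {{u, v}})" by (simp add: graphic_matroid_def)
  then have "acyclic_edges (insert {u, v} (C - {{u, v}}))"
    using nc by (rule not_conn_imp_acyclic_insert)
  also have "insert {u, v} (C - {{u, v}}) = C" using e by auto
  finally show False using C by (auto simp: circuits_def graphic_matroid_def)
qed

text \<open>A minimal dependent subset of \<open>insert {u, v} F\<close> is a circuit, and it has to
  use the new edge because \<open>F\<close> is a forest.\<close>

lemma conn_imp_circuit:
  assumes fin: "finite F" and sub: "insert {u, v} F \<subseteq> E" and F: "acyclic_edges F"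
    and conn: "(u, v) \<in> conn F" and new: "{u, v} \<notin> F" "u \<noteq> v"
  obtains C where "C \<in> circuits (graphic_matroid E)" "{u, v} \<in> C" "C \<subseteq> insert {u, v} F"
proof -
  define D where "D = {C. C \<subseteq> insert {u, v} F \<and> \<not> acyclic_edges C}"
  have "finite D" using fin by (auto simp: D_def intro: finite_subset[of _ "Pow (insert {u, v} F)"])
  moreover have "insert {u, v} F \<in> D"
    using acyclic_insert_imp_not_conn[OF _ new] conn by (auto simp: D_def)
  ultimately obtain C where C: "C \<in> D" "\<And>C'. C' \<in> D \<Longrightarrow> C' \<subseteq> C \<Longrightarrow> C = C'"
    using finite_has_minimal[of D] by auto
  have "C' \<in> indep (graphic_matroid E)" if "C' \<subset> C" for C'
    using C(1) C(2)[of C'] that sub by (auto simp: D_def graphic_matroid_def)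
  then have "C \<in> circuits (graphic_matroid E)"
    using C(1) sub by (auto simp: circuits_def graphic_matroid_def D_def)
  moreover have "{u, v} \<in> C"
  proof (rule ccontr)
    assume "{u, v} \<notin> C"
    then have "C \<subseteq> F" using C(1) by (auto simp: D_def)
    then show False using acyclic_edges_subset[OF F] C(1) by (auto simp: D_def)
  qed
  ultimately show ?thesis using that C(1) by (auto simp: D_def)
qed

lemma linear_order_on_finite_least:
  assumes "linear_order_on E r" and "finite A" and "A \<noteq> {}" and "A \<subseteq> E"
  obtains m where "m \<in> A" "\<And>x. x \<in> A \<Longrightarrow> (m, x) \<in> r"
proof -
  have r: "refl_on E r" "trans r" "total_on E r"
    using assms(1) by (auto simp: order_on_defs)
  have "\<exists>m\<in>A. \<forall>x\<in>A. (m, x) \<in> r"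
    using assms(2-4)
  proof (induction rule: finite_ne_induct)
    case (singleton x)
    then show ?case using r(1) by (auto simp: refl_on_def)
  next
    case (insert x A)
    then obtain m where m: "m \<in> A" "\<And>y. y \<in> A \<Longrightarrow> (m, y) \<in> r" by auto
    have "(m, x) \<in> r \<or> (x, m) \<in> r"
      using r(1,3) insert.prems m(1) by (cases "x = m") (auto simp: refl_on_def total_on_def)
    then show ?case
    proof
      assume "(x, m) \<in> r"
      then have "(x, y) \<in> r" if "y \<in> A" for y using m(2)[OF that] r(2) by (meson transD)
      then show ?thesis using r(1) insert.prems by (auto simp: refl_on_def)
    qed (use m in auto)
  qed
  then show ?thesis using that by blast
qed

text \<open>Among the edges joining different components of an NBC forest, the smallest one can be added
  without creating a broken circuit: the missing smallest edge of such a circuit would join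
  different components as well.\<close>

lemma nbc_facet_spanning:
  assumes fin: "finite E" and edges: "\<And>e. e \<in> E \<Longrightarrow> card e = 2" and r: "linear_order_on E r"
    and F: "F \<in> facets (nbc_complex (graphic_matroid E) r)" and uv: "{u, v} \<in> E"
  shows "(u, v) \<in> conn F"
proof (rule ccontr)
  assume "(u, v) \<notin> conn F"
  define B where "B = {e \<in> E. \<exists>u v. e = {u, v} \<and> (u, v) \<notin> conn F}"
  have "finite B" "B \<noteq> {}" "B \<subseteq> E"
    using fin uv \<open>(u, v) \<notin> conn F\<close> by (auto simp: B_def)
  then obtain e where e: "e \<in> B" "\<And>x. x \<in> B \<Longrightarrow> (e, x) \<in> r"
    using linear_order_on_finite_least[OF r] by metis
  obtain a b where ab: "e = {a, b}" "(a, b) \<notin> conn F" "e \<in> E" using e(1) by (auto simp: B_def)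
  have FX: "F \<in> nbc_complex (graphic_matroid E) r" using F by (simp add: facets_def)
  then have FE: "F \<subseteq> E" "acyclic_edges F" by (auto simp: nbc_complex_def graphic_matroid_def)
  have eF: "e \<notin> F" using ab conn_edge by metis
  have "insert e F \<in> nbc_complex (graphic_matroid E) r"
    unfolding nbc_complex_def
  proof (intro CollectI conjI notI)
    show "insert e F \<in> indep (graphic_matroid E)"
      using FE ab not_conn_imp_acyclic_insert[OF FE(2) ab(2)] by (simp add: graphic_matroid_def)
    assume "\<exists>B\<in>broken_circuits (graphic_matroid E) r. B \<subseteq> insert e F"
    then obtain C f where C: "C \<in> circuits (graphic_matroid E)" "f \<in> C" "C - {f} \<subseteq> insert e F"
      and min: "\<And>x. x \<in> C \<Longrightarrow> (f, x) \<in> r"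
      unfolding broken_circuits_def by blast
    \<comment> \<open>Otherwise the broken circuit \<open>C - {f}\<close> would already lie in
      \<open>F\<close>.\<close>
    have eC: "e \<in> C" "e \<noteq> f"
    proof -
      have "\<not> C - {f} \<subseteq> F"
        using FX C(1,2) min unfolding nbc_complex_def broken_circuits_def by blast
      then show "e \<in> C" "e \<noteq> f" using C(3) by auto
    qed
    have "f \<in> E" using C(1,2) by (auto simp: circuits_def graphic_matroid_def)
    then obtain x y where xy: "f = {x, y}" using edges by (meson card_2_iff)
    \<comment> \<open>\<open>f\<close> precedes \<open>e\<close> as the smallest edge of
      \<open>C\<close>, whereas \<open>e\<close> is the smallest edge between different
      components.\<close>
    have "f \<notin> B"
    proof
      assume "f \<in> B"
      then have "(e, f) \<in> r" by (rule e(2))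
      moreover have "(f, e) \<in> r" using min eC(1) .
      ultimately show False using r eC(2) by (auto simp: order_on_defs antisym_def)
    qed
    then have f: "(x, y) \<in> conn F" using \<open>f \<in> E\<close> xy by (auto simp: B_def)
    have "(a, b) \<in> conn (C - {e})" using circuit_conn[OF C(1)] eC(1) ab(1) by auto
    \<comment> \<open>The ends of \<open>f\<close> are connected inside \<open>F\<close>, so
      \<open>f\<close> can be replaced by a path there and the rest of the circuit joins the ends of
      \<open>e\<close> in \<open>F\<close>.\<close>
    moreover have "conn (C - {e}) \<subseteq> conn F"
    proof (rule conn_subset)
      fix p q assume "{p, q} \<in> C - {e}"
      then have "{p, q} \<in> F \<or> {p, q} = {x, y}" using C(3) xy by auto
      then show "(p, q) \<in> conn F"
        using f conn_sym[OF f] by (auto simp: doubleton_eq_iff intro: conn_edge)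
    qed
    ultimately show False using ab(2) by auto
  qed
  then have "insert e F = F" using F by (auto simp: facets_def)
  then show False using eF by auto
qed

lemma facet_extends:
  assumes "finite X" and "S \<in> X"
  obtains F where "F \<in> facets X" "S \<subseteq> F"
proof -
  obtain F where "F \<in> X" "S \<subseteq> F" "\<And>F'. F' \<in> X \<Longrightarrow> F \<subseteq> F' \<Longrightarrow> F = F'"
    using finite_has_maximal2[OF assms] by metis
  then show ?thesis using that by (force simp: facets_def)
qed

lemma graphic_matroid_truncated:
  assumes E: "simple_graph V E"
  shows "truncated_graphic_matroid (graphic_matroid E)"
proof -
  let ?M = "graphic_matroid E"
  have "E \<subseteq> Pow V" "finite V" using E by (auto simp: simple_graph_def)
  then have fin: "finite E" using finite_subset by blast
  have finI: "finite (indep ?M)"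
    by (rule finite_subset[of _ "Pow E"]) (use fin in \<open>auto simp: graphic_matroid_def\<close>)
  have finB: "finite (bases ?M)"
    by (rule finite_subset[OF _ finI]) (auto simp: bases_def)
  have "card I \<le> matroid_rank ?M" if I: "I \<in> indep ?M" for I
  proof -
    obtain B where B: "B \<in> facets (indep ?M)" "I \<subseteq> B" using facet_extends[OF finI I] .
    then have "B \<in> bases ?M" by (simp add: facets_def bases_def)
    moreover have "finite B"
      using B fin by (auto simp: facets_def graphic_matroid_def intro: finite_subset)
    then have "card I \<le> card B" using B(2) by (rule card_mono)
    ultimately show ?thesis
      unfolding matroid_rank_def using finB by (meson Max_ge finite_imageI imageI le_trans)
  qed
  then have "truncation (matroid_rank ?M) ?M = ?M"
    by (auto simp: truncation_def prod_eq_iff)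
  then show ?thesis
    using E unfolding truncated_graphic_matroid_def by (metis order_refl)
qed

text \<open>Prescribes the order between classes; ties are broken by an enumeration of
  \<open>E\<close>, which is injective as \<open>E\<close> is finite.\<close>

definition priority_order :: "('a \<Rightarrow> nat) \<Rightarrow> 'a set \<Rightarrow> 'a rel" where
  "priority_order c E = {(x, y) \<in> E \<times> E. c x < c y \<or> c x = c y \<and> to_nat_on E x \<le> to_nat_on E y}"

lemma linear_order_priority_order:
  assumes "finite E"
  shows "linear_order_on E (priority_order c E)"
proof -
  have inj: "to_nat_on E x = to_nat_on E y \<longleftrightarrow> x = y" if "x \<in> E" "y \<in> E" for x y
    using that assms by (simp add: countable_finite)
  show ?thesis
    unfolding order_on_defs
  proof (intro conjI)
    show "total_on E (priority_order c E)"
      by (auto simp: total_on_def priority_order_def)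
    show "trans (priority_order c E)"
      by (rule transI) (auto simp: priority_order_def)
    show "antisym (priority_order c E)"
      by (rule antisymI) (auto simp: priority_order_def inj)
    show "refl_on E (priority_order c E)"
      by (auto simp: refl_on_def priority_order_def)
  qed (auto simp: priority_order_def)
qed

section \<open>The bottleneck graph\<close>

text \<open>The theorem asks for a matroid over \<open>nat set\<close>, so vertices are coded as
  numbers; the successors keep the three kinds apart.\<close>

definition hub :: nat where "hub = prod_encode (0, 0)"
definition center :: "nat \<Rightarrow> nat" where "center i = prod_encode (Suc i, 0)"
definition leaf :: "nat \<Rightarrow> nat \<Rightarrow> nat" where "leaf i t = prod_encode (Suc i, Suc t)"

lemma vertex_eq [simp]:
  "center i = center j \<longleftrightarrow> i = j" "leaf i s = leaf j t \<longleftrightarrow> i = j \<and> s = t"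
  "hub \<noteq> center i" "center i \<noteq> hub" "hub \<noteq> leaf i s" "leaf i s \<noteq> hub"
  "center i \<noteq> leaf j s" "leaf j s \<noteq> center i"
  by (simp_all add: hub_def center_def leaf_def)

text \<open>Replaces the case combinator of a datatype: parents, heights and colours are given by
  their values on the hub, the centres and the leaves.\<close>

definition vertex_case :: "'a \<Rightarrow> (nat \<Rightarrow> 'a) \<Rightarrow> (nat \<Rightarrow> nat \<Rightarrow> 'a) \<Rightarrow> nat \<Rightarrow> 'a" where
  "vertex_case a f g x = (case prod_decode x of (i, t) \<Rightarrow>
     if i = 0 then a else if t = 0 then f (i - 1) else g (i - 1) (t - 1))"

lemma vertex_case_simps [simp]:
  "vertex_case a f g hub = a" "vertex_case a f g (center i) = f i"
  "vertex_case a f g (leaf i t) = g i t"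
  by (simp_all add: vertex_case_def hub_def center_def leaf_def)

definition spoke :: "nat \<Rightarrow> nat \<Rightarrow> nat set" where "spoke i t = {hub, leaf i t}"
definition twig :: "nat \<Rightarrow> nat \<Rightarrow> nat set" where "twig i t = {center i, leaf i t}"
definition cross_edge :: "nat \<Rightarrow> nat \<Rightarrow> nat set" where "cross_edge i j = {center i, center j}"

lemma edge_eq [simp]:
  "spoke i s = spoke j t \<longleftrightarrow> i = j \<and> s = t" "twig i s = twig j t \<longleftrightarrow> i = j \<and> s = t"
  "spoke i s \<noteq> twig j t" "twig j t \<noteq> spoke i s" "spoke i s \<noteq> cross_edge j k"
  "cross_edge j k \<noteq> spoke i s" "twig i s \<noteq> cross_edge j k" "cross_edge j k \<noteq> twig i s"
  by (auto simp: spoke_def twig_def cross_edge_def doubleton_eq_iff)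

definition spokes :: "nat set \<Rightarrow> nat \<Rightarrow> nat set set" where
  "spokes I q = (\<lambda>(i, t). spoke i t) ` (I \<times> {..<q})"
definition twigs :: "nat set \<Rightarrow> nat \<Rightarrow> nat set set" where
  "twigs I q = (\<lambda>(i, t). twig i t) ` (I \<times> {..<q})"
definition cross :: "nat \<Rightarrow> nat set set" where
  "cross N = (\<lambda>(i, j). cross_edge i j) ` ({..<N} \<times> {N..<2 * N})"

definition vertices :: "nat \<Rightarrow> nat \<Rightarrow> nat set" where
  "vertices N q = insert hub (center ` {..<2 * N} \<union> (\<lambda>(i, t). leaf i t) ` ({..<2 * N} \<times> {..<q}))"
definition edges :: "nat \<Rightarrow> nat \<Rightarrow> nat set set" where
  "edges N q = cross N \<union> twigs {..<2 * N} q \<union> spokes {..<2 * N} q"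

text \<open>Cross edges are smallest so that opposite spokes complete a broken circuit. Spokes are
  largest so that a circuit with a spoke as its smallest edge would consist of spokes alone, which
  is impossible.\<close>

definition rank_class :: "nat \<Rightarrow> nat \<Rightarrow> nat set \<Rightarrow> nat" where
  "rank_class N q e = (if e \<in> cross N then 0 else if e \<in> twigs {..<2 * N} q then 1 else 2)"

lemma rank_class_simps:
  "e \<in> cross N \<Longrightarrow> rank_class N q e = 0"
  "e \<in> twigs {..<2 * N} q \<Longrightarrow> rank_class N q e = 1"
  "e \<in> spokes {..<2 * N} q \<Longrightarrow> rank_class N q e = 2"
  by (auto simp: rank_class_def cross_def twigs_def spokes_def)

lemma finite_spokes: "finite I \<Longrightarrow> finite (spokes I q)"
  and finite_twigs: "finite I \<Longrightarrow> finite (twigs I q)"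
  and finite_cross: "finite (cross N)"
  by (simp_all add: spokes_def twigs_def cross_def)

lemma card_twigs: "finite I \<Longrightarrow> card (twigs I q) = card I * q"
  unfolding twigs_def by (subst card_image) (auto simp: inj_on_def)

lemma card_spokes_le: "finite I \<Longrightarrow> card (spokes I q) \<le> card I * q"
  unfolding spokes_def by (rule order_trans[OF card_image_le]) auto

lemma card_cross_le: "card (cross N) \<le> N * N"
  unfolding cross_def by (rule order_trans[OF card_image_le]) auto

lemma finite_edges: "finite (edges N q)"
  by (simp add: edges_def finite_spokes finite_twigs finite_cross)

lemma card_edges_le: "card (edges N q) \<le> N * N + 4 * N * q"
proof -
  have "card (edges N q) \<le> card (cross N) + card (twigs {..<2 * N} q) + card (spokes {..<2 * N} q)"
    unfolding edges_def by (meson add_le_mono1 card_Un_le le_trans)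
  then show ?thesis
    using card_cross_le[of N] card_spokes_le[of "{..<2 * N}" q] by (simp add: card_twigs)
qed

lemma card_vertices: "card (vertices N q) = 1 + 2 * N + 2 * N * q"
proof -
  let ?L = "(\<lambda>(i, t). leaf i t) ` ({..<2 * N} \<times> {..<q})"
  have "card (center ` {..<2 * N} \<union> ?L) = card (center ` {..<2 * N}) + card ?L"
    by (rule card_Un_disjoint) auto
  moreover have "card (center ` {..<2 * N}) = 2 * N"
    by (subst card_image) (auto simp: inj_on_def)
  moreover have "card ?L = 2 * N * q"
    by (subst card_image) (auto simp: inj_on_def)
  moreover have "hub \<notin> center ` {..<2 * N} \<union> ?L" by auto
  ultimately show ?thesis unfolding vertices_def by (subst card_insert_disjoint) auto
qed

lemma edges_sub_vertices: "e \<in> edges N q \<Longrightarrow> e \<subseteq> vertices N q \<and> card e = 2"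
  by (auto simp: edges_def cross_def twigs_def spokes_def vertices_def spoke_def twig_def
      cross_edge_def card_insert_if)

lemma simple_graph_edges: "simple_graph (vertices N q) (edges N q)"
  using edges_sub_vertices by (auto simp: simple_graph_def vertices_def)

lemma conn_hub:
  assumes "q > 0" and x: "x \<in> vertices N q"
  shows "(hub, x) \<in> conn (edges N q)"
proof -
  have leaf: "(hub, leaf i t) \<in> conn (edges N q)" if "i < 2 * N" "t < q" for i t
    using that by (intro conn_edge) (auto simp: edges_def spokes_def spoke_def)
  have twig: "(leaf i t, center i) \<in> conn (edges N q)" if "i < 2 * N" "t < q" for i t
    using that by (intro conn_edge) (auto simp: edges_def twigs_def twig_def insert_commute)
  show ?thesis
    using x leaf conn_trans[OF leaf[of _ 0] twig[of _ 0]] \<open>q > 0\<close>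
    by (auto simp: vertices_def)
qed

section \<open>Forests from which facets of the link are grown\<close>

definition seed :: "nat \<Rightarrow> nat \<Rightarrow> nat set \<Rightarrow> (nat \<Rightarrow> nat) \<Rightarrow> nat set set" where
  "seed N q I t = twigs {..<2 * N} q \<union> (\<lambda>i. spoke i (t i)) ` I"

lemma acyclic_seed: "acyclic_edges (seed N q I t)"
proof (rule acyclic_edges_parent)
  fix e assume "e \<in> seed N q I t"
  \<comment> \<open>Stars in \<open>I\<close> hang from the hub through the chosen leaf: the heights
    are 0 for the hub, 1 for that leaf, 2 for the centre and 3 for the other leaves. A star outside
    \<open>I\<close> is rooted at its centre.\<close>
  let ?p = "vertex_case hub (\<lambda>i. leaf i (t i)) (\<lambda>i s. if i \<in> I \<and> s = t i then hub else center i)"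
  let ?h = "vertex_case 0 (\<lambda>i. 2) (\<lambda>i s. if i \<in> I \<and> s = t i then 1 else 3) :: nat \<Rightarrow> nat"
  consider i s where "e = twig i s" | i where "e = spoke i (t i)" "i \<in> I"
    using \<open>e \<in> seed N q I t\<close> by (auto simp: seed_def twigs_def)
  then show "\<exists>v. e = {v, ?p v} \<and> ?h (?p v) < ?h v"
  proof cases
    case (1 i s)
    then show ?thesis
      \<comment> \<open>On the chosen twig the centre is the child; on all other twigs it is the
        parent.\<close>
      by (cases "i \<in> I \<and> s = t i"; intro exI[of _ "if i \<in> I \<and> s = t i then center i else leaf i s"])
        (auto simp: twig_def)
  next
    case (2 i)
    then show ?thesis by (intro exI[of _ "leaf i (t i)"]) (auto simp: spoke_def)
  qed
qed

lemma acyclic_spokes: "acyclic_edges (spokes I q)"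
  by (rule acyclic_edges_parent[where p = "\<lambda>_. hub" and h = "vertex_case 0 (\<lambda>_. 1) (\<lambda>_ _. 1)"])
    (auto simp: spokes_def spoke_def)

section \<open>The broken circuit complex of the bottleneck graph\<close>

locale gadget =
  fixes N q :: nat and r :: "nat set rel"
  assumes q: "q > 0" and N: "N > 0" and r: "linear_order_on (edges N q) r"
    and prio: "\<And>x y. x \<in> edges N q \<Longrightarrow> y \<in> edges N q \<Longrightarrow>
      rank_class N q x < rank_class N q y \<Longrightarrow> (x, y) \<in> r"
begin

abbreviation "M \<equiv> graphic_matroid (edges N q)"
abbreviation "X \<equiv> nbc_complex M r"
abbreviation "\<tau> \<equiv> twigs {..<2 * N} q"

lemma rD: "(x, y) \<in> r \<Longrightarrow> (y, x) \<in> r \<Longrightarrow> x = y"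
  using r by (auto simp: order_on_defs antisym_def)

lemma finite_X: "finite X"
  by (rule finite_subset[of _ "Pow (edges N q)"])
    (auto simp: nbc_complex_def graphic_matroid_def finite_edges)

text \<open>The cases are the kinds of the missing smallest edge \<open>f\<close>. A cross edge
  joins different components of the seed, a twig belongs to the seed, which is a forest, and a spoke
  leaves room only for spokes in the circuit.\<close>

lemma seed_nbc:
  assumes I: "I \<subseteq> {..<2 * N}" and side: "I \<subseteq> {..<N} \<or> I \<subseteq> {N..}"
    and t: "\<And>i. i \<in> I \<Longrightarrow> t i < q"
  shows "seed N q I t \<in> X"
  unfolding nbc_complex_def
proof (intro CollectI conjI notI)
  have sub: "seed N q I t \<subseteq> edges N q"
    using I t by (auto simp: seed_def edges_def spokes_def)
  then show "seed N q I t \<in> indep M" by (simp add: graphic_matroid_def acyclic_seed)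
  assume "\<exists>B\<in>broken_circuits M r. B \<subseteq> seed N q I t"
  then obtain C f where C: "C \<in> circuits M" "f \<in> C" "C - {f} \<subseteq> seed N q I t"
    and min: "\<And>x. x \<in> C \<Longrightarrow> (f, x) \<in> r"
    unfolding broken_circuits_def by blast
  have CE: "C \<subseteq> edges N q" "\<not> acyclic_edges C"
    using C(1) by (auto simp: circuits_def graphic_matroid_def)
  consider i j where "f = cross_edge i j" "i < N" "N \<le> j" "j < 2 * N"
    | "f \<in> \<tau>" | "f \<in> spokes {..<2 * N} q"
    using CE(1) C(2) by (auto simp: edges_def cross_def)
  then show False
  proof cases
    case (1 i j)
    have "(center i, center j) \<in> conn (C - {f})"
      using circuit_conn[OF C(1), of "center i" "center j"] C(2) 1(1) by (simp add: cross_edge_def)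
    then have conn: "(center i, center j) \<in> conn (seed N q I t)"
      using conn_mono[OF C(3)] by auto
    \<comment> \<open>The hub and all stars in \<open>I\<close> share the colour \<open>0\<close>,
      every other star has its own. As \<open>I\<close> lies on one side, at most one of
      \<open>i\<close> and \<open>j\<close> belongs to it, so their colours differ.\<close>
    let ?c = "vertex_case 0 (\<lambda>i. if i \<in> I then 0 else Suc i) (\<lambda>i _. if i \<in> I then 0 else Suc i)"
    have "?c u = ?c v" if "{u, v} \<in> seed N q I t" for u v
      using that by (auto simp: seed_def twigs_def twig_def spoke_def doubleton_eq_iff)
    then have "?c (center i) = ?c (center j)" by (rule conn_invariant[OF conn])
    then show False using 1 side by (auto split: if_splits)
  next
    case 2
    then have "C \<subseteq> seed N q I t" using C(3) by (auto simp: seed_def)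
    then show False using acyclic_edges_subset[OF acyclic_seed] CE(2) by blast
  next
    case 3
    have "C \<subseteq> spokes {..<2 * N} q"
    proof
      fix x assume x: "x \<in> C"
      show "x \<in> spokes {..<2 * N} q"
      proof (rule ccontr)
        assume n: "x \<notin> spokes {..<2 * N} q"
        then have "x \<in> cross N \<union> \<tau>" using x CE(1) by (auto simp: edges_def)
        then have "rank_class N q x < rank_class N q f"
          using rank_class_simps(3)[OF 3] rank_class_simps(1,2)[of x N q] by auto
        then have "(x, f) \<in> r" using x C(2) CE(1) by (intro prio) auto
        then have "x = f" using min[OF x] rD by blast
        then show False using n 3 by simp
      qed
    qed
    then show False using acyclic_edges_subset[OF acyclic_spokes] CE(2) by blast
  qed
qed

lemma facet_acyclic:
  assumes "\<sigma> \<in> facets X"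
  shows "\<sigma> \<subseteq> edges N q" "acyclic_edges \<sigma>" "finite \<sigma>"
  using assms finite_subset[OF _ finite_edges[of N q]]
  by (auto simp: facets_def nbc_complex_def graphic_matroid_def)

text \<open>Facets are spanning trees by \<open>nbc_facet_spanning\<close>, which forces their size.
  Removing the \<open>2 * N * q\<close> edges of \<open>\<tau>\<close> then leaves
  \<open>2 * N\<close>, the purity required by \<open>pure_facets\<close>.\<close>

lemma card_facet:
  assumes \<sigma>: "\<sigma> \<in> facets X"
  shows "card \<sigma> = 2 * N + 2 * N * q"
proof -
  have "card \<sigma> + 1 = card (vertices N q)"
  proof (rule card_spanning_tree)
    show "finite (vertices N q)" "vertices N q \<noteq> {}" by (auto simp: vertices_def)
    show "acyclic_edges \<sigma>" using facet_acyclic[OF \<sigma>] by simp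
    show "e \<subseteq> vertices N q \<and> card e = 2" if "e \<in> \<sigma>" for e
      using facet_acyclic[OF \<sigma>] that by (intro edges_sub_vertices) auto
    have "conn (edges N q) \<subseteq> conn \<sigma>"
      by (rule conn_subset)
        (rule nbc_facet_spanning[OF finite_edges _ r \<sigma>], use edges_sub_vertices in blast)
    then have "(hub, u) \<in> conn \<sigma>" if "u \<in> vertices N q" for u
      using conn_hub[OF q that] by auto
    then show "(u, v) \<in> conn \<sigma>" if "u \<in> vertices N q" "v \<in> vertices N q" for u v
      using that by (metis conn_sym conn_trans)
  qed
  then show ?thesis by (simp add: card_vertices)
qed

text \<open>Two spokes at one star close a four-cycle with two edges of
  \<open>\<tau>\<close>.\<close>

lemma facet_spoke_unique:
  assumes \<sigma>: "\<sigma> \<in> facets X" "\<tau> \<subseteq> \<sigma>" and "i < 2 * N" "s < q" "t < q"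
    and sp: "spoke i s \<in> \<sigma>" "spoke i t \<in> \<sigma>"
  shows "s = t"
proof (rule ccontr)
  assume "s \<noteq> t"
  define F where "F = \<sigma> - {spoke i s}"
  have tw: "twig i s \<in> F" "twig i t \<in> F" "spoke i t \<in> F"
    using assms \<open>s \<noteq> t\<close> by (auto simp: F_def twigs_def)
  have "(hub, leaf i t) \<in> conn F" "(leaf i t, center i) \<in> conn F" "(center i, leaf i s) \<in> conn F"
    using tw by (auto intro!: conn_edge simp: twig_def spoke_def insert_commute)
  then have "(hub, leaf i s) \<in> conn F" by (metis conn_trans)
  moreover have "insert {hub, leaf i s} F = \<sigma>" "{hub, leaf i s} \<notin> F"
    using sp(1) by (auto simp: F_def spoke_def)
  ultimately show False
    using acyclic_insert_imp_not_conn[of hub "leaf i s" F] facet_acyclic(2)[OF \<sigma>(1)] by simp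
qed

text \<open>The five-cycle through two spokes on different sides has its smallest edge in \<open>cross N\<close>.\<close>

lemma facet_one_sided:
  assumes \<sigma>: "\<sigma> \<in> facets X" "\<tau> \<subseteq> \<sigma>" and ij: "i < N" "N \<le> j" "j < 2 * N" and st: "s < q" "t < q"
    and sp: "spoke i s \<in> \<sigma>" "spoke j t \<in> \<sigma>"
  shows False
proof -
  define F where "F = {twig i s, spoke i s, spoke j t, twig j t}"
  have "twig i s \<in> \<tau>" "twig j t \<in> \<tau>" using ij st by (auto simp: twigs_def image_iff)
  then have F\<sigma>: "F \<subseteq> \<sigma>" using \<sigma>(2) sp by (auto simp: F_def)
  then have "acyclic_edges F" using facet_acyclic[OF \<sigma>(1)] acyclic_edges_subset by blast
  have "(center i, leaf i s) \<in> conn F" "(leaf i s, hub) \<in> conn F"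
    "(hub, leaf j t) \<in> conn F" "(leaf j t, center j) \<in> conn F"
    by (auto intro!: conn_edge simp: F_def twig_def spoke_def insert_commute)
  then have conn: "(center i, center j) \<in> conn F" by (metis conn_trans)
  have cross: "{center i, center j} \<in> cross N" using ij by (auto simp: cross_def cross_edge_def)
  have "cross_edge i j \<notin> F" by (simp add: F_def)
  then have new: "{center i, center j} \<notin> F" by (simp add: cross_edge_def)
  \<comment> \<open>Any circuit through the cross edge inside this set will do: all its other edges
    are twigs or spokes, so the cross edge is its smallest.\<close>
  obtain C where C: "C \<in> circuits M" "{center i, center j} \<in> C" "C \<subseteq> insert {center i, center j} F"
  proof (rule conn_imp_circuit[OF _ _ \<open>acyclic_edges F\<close> conn new])
    show "insert {center i, center j} F \<subseteq> edges N q"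
      using F\<sigma> facet_acyclic(1)[OF \<sigma>(1)] cross by (auto simp: edges_def)
  qed (use ij in \<open>auto simp: F_def\<close>)
  have "C - {{center i, center j}} \<in> broken_circuits M r"
    unfolding broken_circuits_def
  proof (intro CollectI exI conjI ballI)
    fix x assume x: "x \<in> C"
    have CE: "C \<subseteq> edges N q" using C(1) by (auto simp: circuits_def graphic_matroid_def)
    show "({center i, center j}, x) \<in> r"
    proof (cases "x = {center i, center j}")
      case True
      then show ?thesis using r x CE by (auto simp: order_on_defs refl_on_def)
    next
      case False
      then have "x \<in> F" using x C(3) by auto
      then have "rank_class N q x \<noteq> 0" by (auto simp: F_def rank_class_def cross_def)
      then show ?thesis
        using x C(2) CE rank_class_simps(1)[OF cross] by (intro prio) auto
    qed
  qed (use C in auto)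
  moreover have "C - {{center i, center j}} \<subseteq> \<sigma>" using C(3) F\<sigma> by auto
  ultimately show False using \<sigma>(1) by (auto simp: facets_def nbc_complex_def)
qed

section \<open>The link of \<open>\<tau>\<close> and its bottleneck\<close>

abbreviation "Y \<equiv> facets (link X \<tau>)"

lemma Y_cases:
  assumes "\<rho> \<in> Y"
  obtains \<sigma> where "\<sigma> \<in> facets X" "\<tau> \<subseteq> \<sigma>" "\<rho> = \<sigma> - \<tau>"
  using assms by (auto simp: facets_link)

lemma spoke_notin_twigs: "spoke i t \<notin> twigs I q"
  by (auto simp: twigs_def)

lemma finite_Y: "finite Y"
  unfolding facets_link using finite_X by (simp add: facets_def[of X])

lemma card_Y: "\<rho> \<in> Y \<Longrightarrow> card \<rho> = 2 * N"
  by (erule Y_cases) (simp add: card_Diff_subset finite_twigs card_twigs card_facet)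

sublocale pure_facets Y "2 * N"
  using finite_Y card_Y N by unfold_locales auto

definition spoked :: "nat set \<Rightarrow> nat set set set" where
  "spoked I = {\<rho> \<in> Y. \<exists>i\<in>I. \<exists>t<q. spoke i t \<in> \<rho>}"

lemma card_spoked_ge:
  assumes I: "I \<subseteq> {..<2 * N}" "I \<noteq> {}" and side: "I \<subseteq> {..<N} \<or> I \<subseteq> {N..}"
  shows "q ^ card I \<le> card (spoked I)"
proof -
  have fI: "finite I" using I finite_subset by blast
  have "\<exists>\<rho>. \<rho> \<in> Y \<and> (\<forall>i\<in>I. spoke i (t i) \<in> \<rho>)" if t: "t \<in> I \<rightarrow>\<^sub>E {..<q}" for t
  proof -
    have "seed N q I t \<in> X" using t by (intro seed_nbc I side) auto
    from facet_extends[OF finite_X this] obtain \<sigma>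
      where "\<sigma> \<in> facets X" "seed N q I t \<subseteq> \<sigma>" .
    then show ?thesis
      by (intro exI[of _ "\<sigma> - \<tau>"]) (auto simp: facets_link seed_def spoke_notin_twigs)
  qed
  then obtain g where g: "\<And>t. t \<in> I \<rightarrow>\<^sub>E {..<q} \<Longrightarrow> g t \<in> Y"
    "\<And>t i. t \<in> I \<rightarrow>\<^sub>E {..<q} \<Longrightarrow> i \<in> I \<Longrightarrow> spoke i (t i) \<in> g t"
    by metis
  \<comment> \<open>The choice \<open>t\<close> can be read off the facet, which has at most one
    spoke per star.\<close>
  have "inj_on g (I \<rightarrow>\<^sub>E {..<q})"
  proof (rule inj_onI)
    fix t t' assume t: "t \<in> I \<rightarrow>\<^sub>E {..<q}" "t' \<in> I \<rightarrow>\<^sub>E {..<q}" "g t = g t'"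
    have "t i = t' i" if i: "i \<in> I" for i
    proof -
      obtain \<sigma> where \<sigma>: "\<sigma> \<in> facets X" "\<tau> \<subseteq> \<sigma>" "g t = \<sigma> - \<tau>" using g(1)[OF t(1)] by (rule Y_cases)
      have "t i < q" "t' i < q" "i < 2 * N" using t i I(1) by auto
      then show ?thesis
        using facet_spoke_unique[OF \<sigma>(1,2), of i "t i" "t' i"] g(2)[OF t(1) i] g(2)[OF t(2) i]
          \<sigma>(3) t(3) by auto
    qed
    then show "t = t'" by (rule PiE_ext[OF t(1,2)])
  qed
  moreover have "g ` (I \<rightarrow>\<^sub>E {..<q}) \<subseteq> spoked I"
  proof
    fix \<rho> assume "\<rho> \<in> g ` (I \<rightarrow>\<^sub>E {..<q})"
    then obtain t where t: "t \<in> I \<rightarrow>\<^sub>E {..<q}" "\<rho> = g t" by auto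
    obtain i where i: "i \<in> I" using I(2) by auto
    have "t i < q" using t(1) i by auto
    with g(1)[OF t(1)] g(2)[OF t(1) i] i show "\<rho> \<in> spoked I"
      unfolding spoked_def t(2) by blast
  qed
  moreover have "finite (spoked I)" using finite_Y by (simp add: spoked_def)
  ultimately have "card (I \<rightarrow>\<^sub>E {..<q}) \<le> card (spoked I)" by (rule card_inj_on_le)
  then show ?thesis by (simp add: card_PiE fI)
qed

abbreviation "T \<equiv> spoked {..<N}"

lemma spoked_right: "spoked {N..<2 * N} \<subseteq> Y - T"
proof
  fix \<rho> assume "\<rho> \<in> spoked {N..<2 * N}"
  then obtain j t where \<rho>: "\<rho> \<in> Y" "N \<le> j" "j < 2 * N" "t < q" "spoke j t \<in> \<rho>"
    by (auto simp: spoked_def)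
  obtain \<sigma> where \<sigma>: "\<sigma> \<in> facets X" "\<tau> \<subseteq> \<sigma>" "\<rho> = \<sigma> - \<tau>" using \<rho>(1) by (rule Y_cases)
  have "\<rho> \<notin> T"
    using facet_one_sided[OF \<sigma>(1,2), of _ j _ t] \<rho> \<sigma>(3) by (auto simp: spoked_def)
  with \<rho>(1) show "\<rho> \<in> Y - T" by simp
qed

definition boundary :: "nat set set set" where
  "boundary = (\<lambda>(x, B). insert x B) ` (spokes {..<N} q \<times> {B. B \<subseteq> cross N \<and> card B = 2 * N - 1})"

lemma card_boundary_le: "card boundary \<le> N * q * (N * N) ^ (2 * N - 1)"
proof -
  have fin: "finite {B. B \<subseteq> cross N \<and> card B = 2 * N - 1}"
    using finite_cross by (auto intro: finite_subset[of _ "Pow (cross N)"])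
  have "card {B. B \<subseteq> cross N \<and> card B = 2 * N - 1} = card (cross N) choose (2 * N - 1)"
    by (rule n_subsets[OF finite_cross])
  \<comment> \<open>Only an upper bound on \<open>card (cross N)\<close> is at hand, so the case of
    too few edges is split off; the binomial coefficient is \<open>0\<close> there.\<close>
  also have "\<dots> \<le> card (cross N) ^ (2 * N - 1)"
    by (cases "2 * N - 1 \<le> card (cross N)") (auto simp: binomial_le_pow binomial_eq_0)
  also have "\<dots> \<le> (N * N) ^ (2 * N - 1)" by (intro power_mono card_cross_le) simp
  finally have le: "card {B. B \<subseteq> cross N \<and> card B = 2 * N - 1} \<le> (N * N) ^ (2 * N - 1)" .
  have "card boundary \<le> card (spokes {..<N} q \<times> {B. B \<subseteq> cross N \<and> card B = 2 * N - 1})"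
    unfolding boundary_def using fin by (intro card_image_le) (simp add: finite_spokes)
  also have "\<dots> = card (spokes {..<N} q) * card {B. B \<subseteq> cross N \<and> card B = 2 * N - 1}"
    by (rule card_cartesian_product)
  also have "\<dots> \<le> N * q * (N * N) ^ (2 * N - 1)"
    using card_spokes_le[of "{..<N}" q] le by (intro mult_le_mono) auto
  finally show ?thesis .
qed

text \<open>A step from \<open>T\<close> to its complement removes the only left spoke.\<close>

lemma boundary_step:
  assumes \<rho>: "\<rho> \<in> T" and \<rho>': "\<rho>' \<in> Y - T" and pos: "pmf (down_up (pmf_of_set Y) \<rho>) \<rho>' \<noteq> 0"
  shows "\<rho> \<in> boundary"
proof -
  have \<rho>Y: "\<rho> \<in> Y" using \<rho> by (simp add: spoked_def)
  obtain i s where sp: "i < N" "s < q" "spoke i s \<in> \<rho>" using \<rho> by (auto simp: spoked_def)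
  obtain x where x: "x \<in> \<rho>" "\<rho> - {x} \<subseteq> \<rho>'" using pmf_down_up_eq_0[OF \<rho>Y, of \<rho>'] pos by blast
  \<comment> \<open>\<open>\<rho>'\<close> has no left spoke, so every left spoke of
    \<open>\<rho>\<close> must be the removed element.\<close>
  have only: "spoke k u = x" if "k < N" "u < q" "spoke k u \<in> \<rho>" for k u
  proof (rule ccontr)
    assume "spoke k u \<noteq> x"
    then have "spoke k u \<in> \<rho>'" using x that by auto
    then show False using \<rho>' that by (auto simp: spoked_def)
  qed
  have xis: "x = spoke i s" using only[OF sp] by simp
  obtain \<sigma> where \<sigma>: "\<sigma> \<in> facets X" "\<tau> \<subseteq> \<sigma>" "\<rho> = \<sigma> - \<tau>" using \<rho>Y by (rule Y_cases)
  \<comment> \<open>Left spokes are excluded by \<open>only\<close>, right spokes by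
    \<open>facet_one_sided\<close>, and twigs by removal of \<open>\<tau>\<close>.\<close>
  have "\<rho> - {x} \<subseteq> cross N"
  proof
    fix y assume y: "y \<in> \<rho> - {x}"
    show "y \<in> cross N"
    proof (rule ccontr)
      assume "y \<notin> cross N"
      then have "y \<in> spokes {..<2 * N} q"
        using y \<sigma>(3) facet_acyclic(1)[OF \<sigma>(1)] by (auto simp: edges_def)
      then obtain k u where k: "k < 2 * N" "u < q" "y = spoke k u" by (auto simp: spokes_def)
      then have "N \<le> k" using only[of k u] y by (cases "k < N") auto
      then show False
        using facet_one_sided[OF \<sigma>(1,2), of i k s u] sp k y \<sigma>(3) by auto
    qed
  qed
  moreover have "card (\<rho> - {x}) = 2 * N - 1"
    using card_Y[OF \<rho>Y] x(1) by (simp add: card_Diff_singleton)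
  moreover have "x \<in> spokes {..<N} q" using sp by (auto simp: xis spokes_def)
  moreover have "\<rho> = insert x (\<rho> - {x})" using x(1) by auto
  ultimately show ?thesis unfolding boundary_def by (intro image_eqI[of _ _ "(x, \<rho> - {x})"]) auto
qed

text \<open>Each boundary state sends out probability at most 1, and no other state of
  \<open>T\<close> sends out any.\<close>

lemma flow_le: "(\<Sum>\<rho>\<in>T. \<Sum>\<rho>'\<in>Y - T. pmf (down_up (pmf_of_set Y) \<rho>) \<rho>') \<le> card boundary"
proof -
  let ?P = "\<lambda>\<rho>. pmf (down_up (pmf_of_set Y) \<rho>)"
  have finT: "finite T" using finite_Y by (simp add: spoked_def)
  have "(\<Sum>\<rho>'\<in>Y - T. ?P \<rho> \<rho>') \<le> (if \<rho> \<in> boundary then 1 else 0)" if "\<rho> \<in> T" for \<rho>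
  proof (cases "\<rho> \<in> boundary")
    case True
    have "(\<Sum>\<rho>'\<in>Y - T. ?P \<rho> \<rho>') = measure_pmf.prob (down_up (pmf_of_set Y) \<rho>) (Y - T)"
      using finite_Y by (simp add: measure_measure_pmf_finite)
    then show ?thesis using True by simp
  next
    case False
    then have "?P \<rho> \<rho>' = 0" if "\<rho>' \<in> Y - T" for \<rho>'
      using boundary_step[OF \<open>\<rho> \<in> T\<close> that] by blast
    then show ?thesis using False by simp
  qed
  then have "(\<Sum>\<rho>\<in>T. \<Sum>\<rho>'\<in>Y - T. ?P \<rho> \<rho>') \<le> (\<Sum>\<rho>\<in>T. if \<rho> \<in> boundary then 1 else 0)"
    by (rule sum_mono)
  also have "\<dots> = card (T \<inter> boundary)" using finT by (simp add: sum.If_cases)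
  also have "\<dots> \<le> card boundary"
    unfolding boundary_def
    using finite_cross finite_spokes[of "{..<N}" q]
    by (intro of_nat_mono card_mono finite_imageI finite_cartesian_product)
      (auto intro: finite_subset[of _ "Pow (cross N)"])
  finally show ?thesis .
qed

lemma \<tau>_in_X: "\<tau> \<in> X"
  using seed_nbc[of "{}"] by (simp add: seed_def)

lemma card_T: "q ^ N \<le> card T" and card_coT: "q ^ N \<le> card (Y - T)"
proof -
  show "q ^ N \<le> card T" using card_spoked_ge[of "{..<N}"] N by auto
  have "{N..<2 * N} \<subseteq> {..<2 * N}" "{N..<2 * N} \<subseteq> {N..}" by auto
  then have "q ^ N \<le> card (spoked {N..<2 * N})" using card_spoked_ge[of "{N..<2 * N}"] N by simp
  also have "\<dots> \<le> card (Y - T)" using finite_Y by (intro card_mono spoked_right) auto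
  finally show "q ^ N \<le> card (Y - T)" .
qed

lemma card_Y_split: "card Y = card T + card (Y - T)"
proof -
  have "T \<subseteq> Y" by (auto simp: spoked_def)
  then have "Y = T \<union> (Y - T)" by auto
  then show ?thesis using finite_Y \<open>T \<subseteq> Y\<close>
    by (metis Diff_disjoint card_Un_disjoint finite_Diff finite_subset)
qed

text \<open>Guarantees that a second eigenvalue exists, so the gap is meaningful.\<close>

lemma card_Y_ge_2: "card Y \<ge> 2"
proof -
  have "1 \<le> q ^ N" using q by simp
  then show ?thesis using card_T card_coT card_Y_split by linarith
qed

lemma link_gap_le: "link_gap X \<tau> \<le> 2 * (N * q * (N * N) ^ (2 * N - 1)) / q ^ N"
proof -
  define a where "a = real (card T)"
  define b where "b = real (card (Y - T))"
  define c where "c = real (N * q * (N * N) ^ (2 * N - 1))"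
  define Q where "Q = real (q ^ N)"
  have pos: "Q > 0" using q by (simp add: Q_def)
  have ab: "a \<ge> Q" "b \<ge> Q"
    using card_T card_coT unfolding a_def b_def Q_def by (simp_all only: of_nat_le_iff)
  have "Y \<noteq> {}" using card_Y_ge_2 by auto
  then have "link_gap X \<tau> = spectral_gap Y (down_up (pmf_of_set Y))"
    by (simp add: link_gap_def link_pmf_uniform[OF finite_X])
  moreover have "spectral_gap Y (down_up (pmf_of_set Y)) * (a * b)
      \<le> card Y * (\<Sum>\<rho>\<in>T. \<Sum>\<rho>'\<in>Y - T. pmf (down_up (pmf_of_set Y) \<rho>) \<rho>')"
    unfolding a_def b_def
  proof (rule spectral_gap_le_conductance[OF finite_Y])
    show "T \<subseteq> Y" by (auto simp: spoked_def)
    show "T \<noteq> {}" using ab(1) pos by (auto simp: a_def)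
    show "T \<noteq> Y" using ab(2) pos by (auto simp: b_def)
    show "set_pmf (down_up (pmf_of_set Y) \<rho>) \<subseteq> Y" if "\<rho> \<in> Y" for \<rho>
      using set_pmf_down_up[OF that] by auto
  qed (rule pmf_down_up_commute)
  moreover have "\<dots> \<le> (a + b) * c"
  proof (rule mult_mono)
    show "real (card Y) \<le> a + b" by (simp add: a_def b_def card_Y_split)
    show "(\<Sum>\<rho>\<in>T. \<Sum>\<rho>'\<in>Y - T. pmf (down_up (pmf_of_set Y) \<rho>) \<rho>') \<le> c"
      using flow_le card_boundary_le unfolding c_def by (meson of_nat_le_iff order_trans)
  qed (auto simp: a_def b_def sum_nonneg)
  ultimately have "link_gap X \<tau> * (a * b) \<le> (a + b) * c" by simp
  then have "link_gap X \<tau> \<le> (a + b) * c / (a * b)"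
    using ab pos by (simp add: pos_le_divide_eq)
  \<comment> \<open>Splitting the fraction lets both sides be bounded separately, without comparing
    their sizes.\<close>
  also have "\<dots> = c / b + c / a" using ab pos by (simp add: field_simps)
  also have "\<dots> \<le> c / Q + c / Q"
    using ab pos by (intro add_mono divide_left_mono) (auto simp: c_def)
  finally show ?thesis by (simp add: c_def Q_def)
qed

end

section \<open>Choice of parameters\<close>

lemma gap_estimate:
  fixes n :: nat
  assumes n: "n \<ge> 1"
  defines "N \<equiv> n + 3"
  shows "2 * real (N * N ^ 6 * (N * N) ^ (2 * N - 1)) / real ((N ^ 6) ^ N) \<le> real n powr (- real n)"
proof -
  define A where "A = N * N ^ 6 * (N * N) ^ (2 * N - 1)"
  define B where "B = (N ^ 6) ^ N"
  \<comment> \<open>The factor \<open>2\<close> is absorbed by \<open>N\<close> and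
    \<open>n ^ n\<close> by \<open>N ^ n\<close>, so that a single power of \<open>N\<close>
    remains.\<close>
  have "2 * A * n ^ n \<le> N * (N * N ^ 6 * (N * N) ^ (2 * N - 1)) * N ^ n"
    unfolding A_def by (intro mult_le_mono power_mono) (auto simp: N_def)
  also have "\<dots> = N ^ (8 + 2 * (2 * N - 1) + n)"
    by (simp add: power_add power_mult power2_eq_square power_mult_distrib eval_nat_numeral)
  \<comment> \<open>With \<open>n = N - 3\<close> the left exponent is \<open>5 * N + 3\<close>, at
    most \<open>6 * N\<close> because \<open>N\<close> is at least 3. This is the reason for
    \<open>q = N ^ 6\<close> and for the shift by 3.\<close>
  also have "\<dots> \<le> N ^ (6 * N)"
    by (rule power_increasing) (auto simp: N_def)
  also have "\<dots> = B" unfolding B_def by (rule power_mult)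
  finally have "real (2 * A * n ^ n) \<le> real B" by (rule of_nat_mono)
  moreover have "B > 0" by (simp add: B_def N_def)
  ultimately have "2 * real A / real B \<le> 1 / real n ^ n"
    using n by (simp add: field_simps)
  moreover have "real n powr (- real n) = 1 / real n ^ n"
    using n by (simp add: powr_minus powr_realpow divide_inverse)
  ultimately show ?thesis by (simp only: A_def B_def)
qed

theorem theorem1p7:
  shows "\<exists>(M :: nat \<Rightarrow> nat set matroid) (ord :: nat \<Rightarrow> nat set rel) (C :: nat) (d :: nat) (c :: real).
    c > 0 \<and>
    (\<forall>n \<ge> 1.
       truncated_graphic_matroid (M n) \<and>
       linear_order_on (ground (M n)) (ord n) \<and>
       card (ground (M n)) \<le> C * n ^ d \<and>
       (\<exists>\<tau> \<in> nbc_complex (M n) (ord n).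
          card (facets (link (nbc_complex (M n) (ord n)) \<tau>)) \<ge> 2 \<and>
          link_gap (nbc_complex (M n) (ord n)) \<tau> \<le> real n powr (- (c * real n))))"
proof -
  define N :: "nat \<Rightarrow> nat" where "N n = n + 3" for n
  define q :: "nat \<Rightarrow> nat" where "q n = N n ^ 6" for n
  define E where "E n = edges (N n) (q n)" for n
  define ord where "ord n = priority_order (rank_class (N n) (q n)) (E n)" for n
  have order: "linear_order_on (E n) (ord n)" for n
    unfolding ord_def by (rule linear_order_priority_order) (simp add: E_def finite_edges)
  have gadget: "gadget (N n) (q n) (ord n)" for n
    using order[of n] by unfold_locales (auto simp: N_def q_def E_def ord_def priority_order_def)
  show ?thesis
  \<comment> \<open>At most \<open>N ^ 2 + 4 * N ^ 7\<close> edges occur, hence at most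
    \<open>5 * N ^ 7\<close>, and \<open>N\<close> is at most \<open>4 * n\<close>; this gives the
    constant and the degree.\<close>
  proof (rule exI[of _ "\<lambda>n. graphic_matroid (E n)"], rule exI[of _ ord],
      rule exI[of _ "5 * 4 ^ 7"], rule exI[of _ 7], rule exI[of _ 1], intro conjI allI impI)
    fix n :: nat assume n: "n \<ge> 1"
    show "truncated_graphic_matroid (graphic_matroid (E n))"
      unfolding E_def by (rule graphic_matroid_truncated[OF simple_graph_edges])
    show "linear_order_on (ground (graphic_matroid (E n))) (ord n)"
      using order by (simp add: graphic_matroid_def)
    have "N n * q n = N n ^ 7" by (simp add: q_def flip: power_Suc)
    then have "card (E n) \<le> N n ^ 2 + 4 * N n ^ 7"
      using card_edges_le[of "N n" "q n"] by (simp add: E_def power2_eq_square mult.assoc)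
    also have "\<dots> \<le> 5 * N n ^ 7"
      using power_increasing[of 2 7 "N n"] by (simp add: N_def)
    also have "\<dots> \<le> 5 * (4 * n) ^ 7"
      using n by (intro mult_le_mono power_mono) (auto simp: N_def)
    finally show "card (ground (graphic_matroid (E n))) \<le> 5 * 4 ^ 7 * n ^ 7"
      by (simp add: graphic_matroid_def power_mult_distrib)
    interpret gadget "N n" "q n" "ord n" by (rule gadget)
    show "\<exists>\<tau>\<in>nbc_complex (graphic_matroid (E n)) (ord n).
        2 \<le> card (facets (link (nbc_complex (graphic_matroid (E n)) (ord n)) \<tau>)) \<and>
        link_gap (nbc_complex (graphic_matroid (E n)) (ord n)) \<tau> \<le> real n powr (- (1 * real n))"
      unfolding E_def
    proof (intro bexI conjI)
      show "2 \<le> card Y" by (rule card_Y_ge_2)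
      show "link_gap X \<tau> \<le> real n powr (- (1 * real n))"
        using link_gap_le gap_estimate[OF n] by (simp add: q_def N_def)
      show "\<tau> \<in> X" by (rule \<tau>_in_X)
    qed
  qed simp
qed

end
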